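(* Let $T$ be a bounded linear operator on a complex separable Hilbert space $H$. Then $$\overline{\operatorname{span}(\mathcal{E}(T))}=\overline{\operatorname{URec}(T)}=\overline{\operatorname{RRec}^{bo}(T)}.$$ Moreover: (a) The following statements are equivalent: (i) $\mathcal{E}(T)\neq\varnothing$; (ii) $\Delta^*\mathrm{Rec}(T)\setminus\{0\}\neq\varnothing$; (iii) $\mathcal{IP}^*\mathrm{Rec}(T)\setminus\{0\}\neq\varnothing$; (iv) $\operatorname{URec}(T)\setminus\{0\}\neq\varnothing$; (v) $\operatorname{FRec}^{bo}(T)\setminus\{0\}\neq\varnothing$; (vi) $\operatorname{UFRec}^{bo}(T)\setminus\{0\}\neq\varnothing$; (vii) $\operatorname{RRec}^{bo}(T)\setminus\{0\}\neq\varnothing$; (viii) $T$ admits a non-trivial invariant probability measure $\mu$ with $\int_H\|z\|^2\,d\mu(z)<\infty$. (b) The following statements are equivalent: (i) the set $\operatorname{span}(\mathcal{E}(T))$ is dense in $H$; (ii) $T$ is $\Delta^*$-recurrent; (iii) $T$ is $\mathcal{IP}^*$-recurrent; (iv) $T$ is uniformly recurrent; (v) the set $\operatorname{FRec}^{bo}(T)$ is dense in $H$; (vi) the set $\operatorname{UFRec}^{bo}(T)$ is dense in $H$; (vii) the set $\operatorname{RRec}^{bo}(T)$ is dense in $H$; (viii) $T$ admits an invariant probability measure $\mu$ with full support and $\int_H\|z\|^2\,d\mu(z)<\infty$.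
   Context: $\mathbb{N}=\{1,2,\dots\}$, $\mathbb{N}_0=\mathbb{N}\cup\{0\}$, $\mathbb{T}=\{z\in\mathbb{C}:|z|=1\}$. The set of unimodular eigenvectors is $\mathcal{E}(T)=\bigcup_{\lambda\in\mathbb{T}}\ker(\lambda-T)\setminus\{0\}$ (and $\operatorname{span}(\varnothing)=\{0\}$). For a point $x$ and a set $A$, $N(x,A)=\{n\in\mathbb{N}_0:T^nx\in A\}$. All topological notions refer to the norm topology. Densities of $A\subset\mathbb{N}_0$: $\underline{\operatorname{dens}}(A)=\liminf_{N\to\infty}\frac{\operatorname{card}(A\cap[0,N])}{N+1}$; $\overline{\operatorname{dens}}(A)=\limsup_{N\to\infty}\frac{\operatorname{card}(A\cap[0,N])}{N+1}$; $\overline{\operatorname{Bd}}(A)=\limsup_{N\to\infty}\left(\max_{m\ge0}\frac{\operatorname{card}(A\cap[m,m+N])}{N+1}\right)$. Families of subsets of $\mathbb{N}_0$: - $A$ is syndetic if there is $m\in\mathbb{N}$ such that $[x,x+m]\cap A\ne\varnothing$ for every $x\in\mathbb{N}_0$; - $A$ is an IP-set if there is a (strictly) increasing sequence $(x_n)_{n\ge1}$ in $\mathbb{N}_0$ with $\{\sum_{n\in F}x_n: F\subset\mathbb{N}\text{ finite non-empty}\}\subset A$; - $A$ is a $\Delta$-set if there is an infinite $B\subset\mathbb{N}_0$ with $(B-B)\cap\mathbb{N}\subset A$. $\mathcal{IP}$ and $\Delta$ denote the families of IP-sets and $\Delta$-sets. For a family $\mathcal{F}$, its dual family is $\mathcal{F}^*=\{A\subset\mathbb{N}_0\text{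 infinite}: A\cap B\neq\varnothing\text{ for all }B\in\mathcal{F}\}$. A point $x$ belongs to $\operatorname{FRec}(T)$, $\operatorname{UFRec}(T)$, $\operatorname{RRec}(T)$, $\operatorname{URec}(T)$, $\mathcal{IP}^*\mathrm{Rec}(T)$, $\Delta^*\mathrm{Rec}(T)$ if, for every neighbourhood $U$ of $x$, respectively: $\underline{\operatorname{dens}}(N(x,U))>0$; $\overline{\operatorname{dens}}(N(x,U))>0$; $\overline{\operatorname{Bd}}(N(x,U))>0$; $N(x,U)$ is syndetic; $N(x,U)\in\mathcal{IP}^*$; $N(x,U)\in\Delta^*$. The operator $T$ is uniformly (resp. $\mathcal{IP}^*$-, $\Delta^*$-) recurrent if $\operatorname{URec}(T)$ (resp. $\mathcal{IP}^*\mathrm{Rec}(T)$, $\Delta^*\mathrm{Rec}(T)$) is dense. The sets $\operatorname{FRec}^{bo}(T)$, $\operatorname{UFRec}^{bo}(T)$, $\operatorname{RRec}^{bo}(T)$ are the intersections of $\operatorname{FRec}(T)$, $\operatorname{UFRec}(T)$, $\operatorname{RRec}(T)$ with the set of $x\in H$ having bounded $T$-orbit $\{T^nx:n\in\mathbb{N}_0\}$. An invariant probability measure is a Borel probability measure $\mu$ with $\mu(T^{-1}(A))=\mu(A)$ for all Borel $A$; it is non-trivial if $\mu\ne\delta_0$, and has full support if $\mu(U)>0$ for every non-empty open $U$. *)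

theory Defs
  imports "HOL-Probability.Probability"
begin

section \<open>Complex separable Hilbert spaces\<close>

class complex_vector = real_vector +
  fixes scaleC :: "complex \<Rightarrow> 'a \<Rightarrow> 'a"  (infixr \<open>*\<^sub>C\<close> 75)
  assumes scaleC_add_right: "a *\<^sub>C (x + y) = a *\<^sub>C x + a *\<^sub>C y"
    and scaleC_add_left: "(a + b) *\<^sub>C x = a *\<^sub>C x + b *\<^sub>C x"
    and scaleC_scaleC: "a *\<^sub>C (b *\<^sub>C x) = (a * b) *\<^sub>C x"
    and scaleC_one: "1 *\<^sub>C x = x"
    and scaleR_scaleC: "scaleR r x = complex_of_real r *\<^sub>C x"

text \<open>The real inner product inherited from \<^class>\<open>real_inner\<close> is the real part of the complex
  one. Since \<open>cinner x x\<close> is real by conjugate symmetry, positive definiteness of \<open>cinner\<close> and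
  \<open>norm x = sqrt (Re (cinner x x))\<close> are inherited from \<^class>\<open>real_inner\<close>.\<close>

class complex_inner = complex_vector + real_inner +
  fixes cinner :: "'a \<Rightarrow> 'a \<Rightarrow> complex"
  assumes cinner_commute: "cinner x y = cnj (cinner y x)"
    and cinner_add_left: "cinner (x + y) z = cinner x z + cinner y z"
    and cinner_scaleC_left: "cinner (c *\<^sub>C x) y = c * cinner x y"
    and inner_eq_Re_cinner: "inner x y = Re (cinner x y)"

class complex_hilbert_space = complex_inner + complete_space
begin

subclass banach ..

end

class separable_complex_hilbert_space = complex_hilbert_space +
  assumes separable: "\<exists>D. countable D \<and> (\<forall>U. open U \<longrightarrow> U \<noteq> {} \<longrightarrow> D \<inter> U \<noteq> {})"

instance separable_complex_hilbert_space \<subseteq> polish_space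
proof
  obtain D :: "'a set" where D: "countable D" "\<And>U. open U \<Longrightarrow> U \<noteq> {} \<Longrightarrow> D \<inter> U \<noteq> {}"
    using separable by blast
  define B where "B = (\<lambda>(d, n). ball d (inverse (real (Suc n)))) ` (D \<times> (UNIV :: nat set))"
  have "topological_basis B"
  proof (rule topological_basisI)
    show "open U" if "U \<in> B" for U
      using that by (auto simp: B_def)
  next
    fix U :: "'a set" and x
    assume "open U" "x \<in> U"
    then obtain e where e: "e > 0" "ball x e \<subseteq> U"
      by (meson open_contains_ball)
    obtain n where n: "inverse (real (Suc n)) < e / 2"
      using reals_Archimedean[of "e / 2"] e(1) by auto
    have "D \<inter> ball x (inverse (real (Suc n))) \<noteq> {}"
      by (rule D(2)) (auto simp: ball_eq_empty simp del: of_nat_Suc)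
    then obtain d where d: "d \<in> D" "dist d x < inverse (real (Suc n))"
      by (auto simp: dist_commute)
    have "ball d (inverse (real (Suc n))) \<subseteq> ball x e"
    proof
      fix y assume "y \<in> ball d (inverse (real (Suc n)))"
      then show "y \<in> ball x e"
        using d(2) n dist_triangle[of x y d] by (simp add: dist_commute)
    qed
    moreover have "ball d (inverse (real (Suc n))) \<in> B"
      using d(1) by (auto simp: B_def)
    ultimately show "\<exists>U'\<in>B. x \<in> U' \<and> U' \<subseteq> U"
      using d(2) e(2) by (intro bexI) auto
  qed
  moreover have "countable B"
    using D(1) by (auto simp: B_def)
  ultimately show "\<exists>B :: 'a set set. countable B \<and> open = generate_topology B"
    by (blast dest: topological_basis_imp_subbasis)
qed

global_interpretation complex_vector: vector_space "scaleC :: complex \<Rightarrow> 'a \<Rightarrow> 'a :: complex_vector"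
  defines cspan = complex_vector.span
  by unfold_locales (simp_all add: scaleC_add_right scaleC_add_left scaleC_scaleC scaleC_one)

definition bounded_clinear :: "('a :: complex_inner \<Rightarrow> 'b :: complex_inner) \<Rightarrow> bool" where
  "bounded_clinear T \<longleftrightarrow> bounded_linear T \<and> (\<forall>c x. T (c *\<^sub>C x) = c *\<^sub>C T x)"

definition unimodular_eigenvectors :: "('a :: complex_inner \<Rightarrow> 'a) \<Rightarrow> 'a set" where
  "unimodular_eigenvectors T = (\<Union>c\<in>{z. cmod z = 1}. {x. c *\<^sub>C x - T x = 0}) - {0}"


section \<open>Densities and families of sets of natural numbers\<close>

definition lower_density :: "nat set \<Rightarrow> ereal" where
  "lower_density A = liminf (\<lambda>N. ereal (real (card (A \<inter> {0..N})) / real (N + 1)))"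

definition upper_density :: "nat set \<Rightarrow> ereal" where
  "upper_density A = limsup (\<lambda>N. ereal (real (card (A \<inter> {0..N})) / real (N + 1)))"

text \<open>For each \<open>N\<close> the maximum is over a finite set, all cardinalities being at most \<open>N + 1\<close>.\<close>

definition upper_Banach_density :: "nat set \<Rightarrow> ereal" where
  "upper_Banach_density A =
     limsup (\<lambda>N. ereal (Max (range (\<lambda>m. real (card (A \<inter> {m..m + N})) / real (N + 1)))))"

lemma finite_range_window_density:
  "finite (range (\<lambda>m. real (card (A \<inter> {m..m + N})) / real (N + 1)))" for A :: "nat set"
proof (rule finite_subset)
  show "range (\<lambda>m. real (card (A \<inter> {m..m + N})) / real (N + 1))
          \<subseteq> (\<lambda>k. real k / real (N + 1)) ` {..N + 1}"
  proof clarify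
    fix m
    have "card (A \<inter> {m..m + N}) \<le> card {m..m + N}"
      by (intro card_mono) auto
    then show "real (card (A \<inter> {m..m + N})) / real (N + 1)
        \<in> (\<lambda>k. real k / real (N + 1)) ` {..N + 1}"
      by (intro imageI) simp
  qed
qed simp

definition syndetic_sets :: "nat set set" where
  "syndetic_sets = {A. \<exists>m\<ge>1. \<forall>x. {x..x + m} \<inter> A \<noteq> {}}"

text \<open>Sequences are indexed from \<open>0\<close> here rather than from \<open>1\<close>.\<close>

definition IP_sets :: "nat set set" where
  "IP_sets = {A. \<exists>x :: nat \<Rightarrow> nat. strict_mono x \<and>
     {\<Sum>n\<in>F. x n | F. finite F \<and> F \<noteq> {}} \<subseteq> A}"

text \<open>The side condition \<open>b' < b\<close> selects the positive differences, so that the truncated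
  subtraction on \<^typ>\<open>nat\<close> is the true one.\<close>

definition Delta_sets :: "nat set set" where
  "Delta_sets = {A. \<exists>B :: nat set. infinite B \<and> {b - b' | b b'. b \<in> B \<and> b' \<in> B \<and> b' < b} \<subseteq> A}"

definition dual_family :: "nat set set \<Rightarrow> nat set set" where
  "dual_family \<F> = {A. infinite A \<and> (\<forall>B\<in>\<F>. A \<inter> B \<noteq> {})}"


section \<open>Recurrence\<close>

definition return_set :: "('a \<Rightarrow> 'a) \<Rightarrow> 'a \<Rightarrow> 'a set \<Rightarrow> nat set" where
  "return_set T x A = {n. (T ^^ n) x \<in> A}"

text \<open>\<open>U\<close> is a neighbourhood of \<open>x\<close> if and only if \<open>x \<in> interior U\<close>.\<close>

definition recurrent_points :: "nat set set \<Rightarrow> ('a :: topological_space \<Rightarrow> 'a) \<Rightarrow> 'a set" where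
  "recurrent_points \<F> T = {x. \<forall>U. x \<in> interior U \<longrightarrow> return_set T x U \<in> \<F>}"

definition FRec :: "('a :: topological_space \<Rightarrow> 'a) \<Rightarrow> 'a set" where
  "FRec T = recurrent_points {A. lower_density A > 0} T"

definition UFRec :: "('a :: topological_space \<Rightarrow> 'a) \<Rightarrow> 'a set" where
  "UFRec T = recurrent_points {A. upper_density A > 0} T"

definition RRec :: "('a :: topological_space \<Rightarrow> 'a) \<Rightarrow> 'a set" where
  "RRec T = recurrent_points {A. upper_Banach_density A > 0} T"

definition URec :: "('a :: topological_space \<Rightarrow> 'a) \<Rightarrow> 'a set" where
  "URec T = recurrent_points syndetic_sets T"

definition IP_star_Rec :: "('a :: topological_space \<Rightarrow> 'a) \<Rightarrow> 'a set" where
  "IP_star_Rec T = recurrent_points (dual_family IP_sets) T"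

definition Delta_star_Rec :: "('a :: topological_space \<Rightarrow> 'a) \<Rightarrow> 'a set" where
  "Delta_star_Rec T = recurrent_points (dual_family Delta_sets) T"

definition bounded_orbit_points :: "('a :: metric_space \<Rightarrow> 'a) \<Rightarrow> 'a set" where
  "bounded_orbit_points T = {x. bounded (range (\<lambda>n. (T ^^ n) x))}"

definition FRec_bo :: "('a :: metric_space \<Rightarrow> 'a) \<Rightarrow> 'a set" where
  "FRec_bo T = FRec T \<inter> bounded_orbit_points T"

definition UFRec_bo :: "('a :: metric_space \<Rightarrow> 'a) \<Rightarrow> 'a set" where
  "UFRec_bo T = UFRec T \<inter> bounded_orbit_points T"

definition RRec_bo :: "('a :: metric_space \<Rightarrow> 'a) \<Rightarrow> 'a set" where
  "RRec_bo T = RRec T \<inter> bounded_orbit_points T"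

definition dense :: "'a :: topological_space set \<Rightarrow> bool" where
  "dense S \<longleftrightarrow> closure S = UNIV"

definition uniformly_recurrent :: "('a :: topological_space \<Rightarrow> 'a) \<Rightarrow> bool" where
  "uniformly_recurrent T \<longleftrightarrow> dense (URec T)"

definition IP_star_recurrent :: "('a :: topological_space \<Rightarrow> 'a) \<Rightarrow> bool" where
  "IP_star_recurrent T \<longleftrightarrow> dense (IP_star_Rec T)"

definition Delta_star_recurrent :: "('a :: topological_space \<Rightarrow> 'a) \<Rightarrow> bool" where
  "Delta_star_recurrent T \<longleftrightarrow> dense (Delta_star_Rec T)"


section \<open>Invariant measures\<close>

definition invariant_prob_measure :: "('a :: topological_space \<Rightarrow> 'a) \<Rightarrow> 'a measure \<Rightarrow> bool" where
  "invariant_prob_measure T \<mu> \<longleftrightarrow> prob_space \<mu> \<and> sets \<mu> = sets borel \<and>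
     (\<forall>A\<in>sets borel. emeasure \<mu> (T -` A) = emeasure \<mu> A)"

text \<open>\<open>return borel 0\<close> is the Dirac measure at \<open>0\<close>.\<close>

definition nontrivial_measure :: "'a :: {topological_space, zero} measure \<Rightarrow> bool" where
  "nontrivial_measure \<mu> \<longleftrightarrow> \<mu> \<noteq> return borel 0"

definition full_support :: "'a :: topological_space measure \<Rightarrow> bool" where
  "full_support \<mu> \<longleftrightarrow> (\<forall>U. open U \<longrightarrow> U \<noteq> {} \<longrightarrow> emeasure \<mu> U > 0)"

definition finite_second_moment :: "'a :: real_normed_vector measure \<Rightarrow> bool" where
  "finite_second_moment \<mu> \<longleftrightarrow> (\<integral>\<^sup>+ z. ennreal ((norm z)\<^sup>2) \<partial>\<mu>) < \<infinity>"


definition all_equivalent :: "bool list \<Rightarrow> bool" where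
  "all_equivalent Ps \<longleftrightarrow> (\<forall>P\<in>set Ps. \<forall>Q\<in>set Ps. P \<longleftrightarrow> Q)"

end

theory Submission
  imports Defs
begin

text \<open>
  Every one of the sets of recurrent points lies between the span of the unimodular eigenvectors
  and its closure, and this one sandwich gives both the equality of closures and the equivalences.

  Upwards from the span: a finite sum of unimodular eigenvectors moves on a compact torus,
  on which \<open>T\<close> acts as a rotation, so some difference of any infinite set of times is a return time.
  The other inclusions compare families of sets of natural numbers, the one that needs a construction
  being that a set which is not syndetic misses some IP-set; uniformly recurrent points have bounded
  orbits because the gaps between visits to a ball are bounded.

  Down to the closure: if \<open>x\<close> is recurrent with bounded orbit and is not in the closed span, choose
  \<open>v\<close> orthogonal to all unimodular eigenvectors with \<open>inner x v > 0\<close>. Recurrence along a set of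
  positive upper Banach density says that a point drawn uniformly from a long window of the orbit
  has, under the first \<open>N\<close> iterates of \<open>T\<close>, bounded second moment and a component along \<open>v\<close> bounded
  from below in mean square. An invariant measure with finite second moment which is not
  concentrated on the orthogonal complement of \<open>v\<close> has the same property. Both cases are therefore
  settled by one theorem, \<open>exists_eigenvector_not_orthogonal\<close>: such data produce a unimodular
  eigenvector that is not orthogonal to \<open>v\<close>.

  That theorem is proved by Fourier analysis on the group of \<open>N\<close>-th roots of unity. Write
  \<open>X\<^sub>n = T\<^sup>n X\<close> for the random orbit and put \<open>Y\<^sub>l = \<Sum>n<N. l\<^sup>-\<^sup>n X\<^sub>n\<close> for each root \<open>l\<close>. By Parseval the sums over
  all \<open>l\<close> of the second moment of \<open>Y\<^sub>l\<close> and of that of its component along \<open>v\<close> are controlled, so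
  some \<open>l\<close> has a good ratio between the two. The sum telescopes, \<open>T Y\<^sub>l - l Y\<^sub>l = l (X\<^sub>N - X\<^sub>0)\<close>, which is
  small compared with the size \<open>sqrt N\<close> of \<open>Y\<^sub>l\<close>. The covariance operator of \<open>Y\<^sub>l\<close> applied to \<open>v\<close>
  and normalised is thus an approximate eigenvector with bounded norm and with inner product with
  \<open>v\<close> bounded from below (\<open>approximate_eigenvector\<close>). Letting \<open>N\<close> grow, a weak limit is an
  eigenvector; weak compactness enters in the form that decreasing bounded closed convex sets of a
  Hilbert space have a common point (\<open>nested_bounded_closed_convex_Inter_nonempty\<close>).

  Conversely, rotating an eigenvector \<open>x\<close> by a uniformly distributed \<open>z\<close> on the circle, independently
  of a random vector with invariant law, gives an invariant law again, with \<open>x + y\<close> in its support if \<open>y\<close> was in the former support.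
  Starting from the point mass at \<open>0\<close>, each point of the span is reached, and a countable mixture of
  these measures has full support when the span is dense.
\<close>

section \<open>Complex inner product spaces\<close>

text \<open>Rotating \<open>x\<close> makes the complex inner product real and nonnegative, which transfers
  the Cauchy--Schwarz inequality from the real inner product.\<close>
lemma cmod_eq_cinner_phase:
  fixes x y :: "'a :: complex_inner"
  obtains c where "cmod c = 1" "inner (c *\<^sub>C x) y = cmod (cinner x y)"
proof (cases "cinner x y = 0")
  case True
  show ?thesis
    by (rule that[of 1]) (simp_all add: inner_eq_Re_cinner cinner_scaleC_left True)
next
  case False
  define c where "c = cnj (cinner x y) / cmod (cinner x y)"
  have "c * cinner x y = complex_of_real (cmod (cinner x y))"
    using False complex_norm_square[of "cinner x y"]
    by (simp add: c_def power2_eq_square divide_simps mult.commute)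
  then show ?thesis
    using False by (intro that[of c]) (simp_all add: c_def norm_divide inner_eq_Re_cinner cinner_scaleC_left)
qed

lemma cinner_scaleC_right: "cinner x (c *\<^sub>C y) = cnj c * cinner x (y :: 'a :: complex_inner)"
  by (metis cinner_commute cinner_scaleC_left complex_cnj_mult)

lemma norm_scaleC: "norm (c *\<^sub>C x) = cmod c * norm (x :: 'a :: complex_inner)"
proof -
  have "cinner (c *\<^sub>C x) (c *\<^sub>C x) = (cmod c)\<^sup>2 * cinner x x"
    using complex_norm_square[of c] by (simp add: cinner_scaleC_left cinner_scaleC_right)
  then have "inner (c *\<^sub>C x) (c *\<^sub>C x) = (cmod c)\<^sup>2 * inner x x"
    by (simp add: inner_eq_Re_cinner flip: of_real_power)
  then have "(norm (c *\<^sub>C x))\<^sup>2 = (cmod c * norm x)\<^sup>2"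
    by (simp add: power2_norm_eq_inner power_mult_distrib)
  then show ?thesis
    by (simp add: power2_eq_iff_nonneg)
qed

lemma cmod_cinner_le: "cmod (cinner x y) \<le> norm x * norm (y :: 'a :: complex_inner)"
proof -
  obtain c where "cmod c = 1" "inner (c *\<^sub>C x) y = cmod (cinner x y)"
    by (rule cmod_eq_cinner_phase)
  then show ?thesis
    by (metis mult_1 norm_cauchy_schwarz norm_scaleC)
qed

lemma cmod_cinner_sq_le: "(cmod (cinner x v))\<^sup>2 \<le> (norm v)\<^sup>2 * (norm (x :: 'a :: complex_inner))\<^sup>2"
  using cmod_cinner_le[of x v] by (metis mult.commute norm_ge_zero power_mono power_mult_distrib)

lemma scaleC_scaleR: "c *\<^sub>C (r *\<^sub>R x) = r *\<^sub>R (c *\<^sub>C (x :: 'a :: complex_vector))"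
  by (simp add: scaleR_scaleC scaleC_scaleC mult.commute)

lemma bounded_linear_scaleC: "bounded_linear (\<lambda>x :: 'a :: complex_inner. c *\<^sub>C x)"
  by (rule bounded_linear_intro[of _ "cmod c"])
     (simp_all add: scaleC_add_right scaleC_scaleR norm_scaleC mult.commute)

lemma bounded_linear_scaleC_left: "bounded_linear (\<lambda>c. c *\<^sub>C (x :: 'a :: complex_inner))"
proof (rule bounded_linear_intro[of _ "norm x"])
  fix r :: real and c :: complex
  show "(r *\<^sub>R c) *\<^sub>C x = r *\<^sub>R (c *\<^sub>C x)"
    by (simp add: scaleR_scaleC scaleC_scaleC scaleR_conv_of_real)
qed (simp_all add: scaleC_add_left norm_scaleC)

lemma cinner_eq_Complex:
  fixes x y :: "'a :: complex_inner"
  shows "cinner x y = Complex (inner x y) (inner x (\<i> *\<^sub>C y))"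
  by (simp add: complex_eq_iff inner_eq_Re_cinner cinner_scaleC_right)

lemma cinner_0_left: "cinner 0 (y :: 'a :: complex_inner) = 0"
  by (metis add_cancel_left_left cinner_add_left)

lemma cinner_sum_left: "cinner (\<Sum>i\<in>I. f i) (y :: 'a :: complex_inner) = (\<Sum>i\<in>I. cinner (f i) y)"
  by (induction I rule: infinite_finite_induct) (simp_all add: cinner_0_left cinner_add_left)

lemma cinner_sum_right: "cinner y (\<Sum>i\<in>I. f i) = (\<Sum>i\<in>I. cinner (y :: 'a :: complex_inner) (f i))"
  by (subst cinner_commute, subst cinner_sum_left, subst cnj_sum, subst (2) cinner_commute) (rule refl)

lemma cinner_self: "cinner x x = complex_of_real ((norm (x :: 'a :: complex_inner))\<^sup>2)"
proof -
  have "Im (cinner x x) = 0"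
    by (metis cinner_commute cnj.sel(2) neg_equal_zero)
  then show ?thesis
    by (simp add: complex_eq_iff power2_norm_eq_inner inner_eq_Re_cinner)
qed

lemma sq_norm_add_le: "(norm (x + y))\<^sup>2 \<le> 2 * (norm x)\<^sup>2 + 2 * (norm (y :: 'a :: real_normed_vector))\<^sup>2"
proof -
  have "(norm (x + y))\<^sup>2 \<le> (norm x + norm y)\<^sup>2"
    by (intro power_mono norm_triangle_ineq) simp
  also have "\<dots> \<le> 2 * (norm x)\<^sup>2 + 2 * (norm y)\<^sup>2"
    using sum_squares_bound[of "norm x" "norm y"] by (simp add: power2_sum)
  finally show ?thesis .
qed

section \<open>Nested convex sets and orthogonal projection in a Hilbert space\<close>

text \<open>This replaces weak compactness of balls. Points of \<open>D n\<close> of almost minimal norm form a Cauchy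
  sequence: the minimal norms \<open>d n\<close> increase to a limit, and the parallelogram law bounds the distance of two
  such points, since their midpoint lies in the larger of the two sets.\<close>
lemma nested_bounded_closed_convex_Inter_nonempty:
  fixes D :: "nat \<Rightarrow> 'a :: {real_inner, complete_space} set"
  assumes closed: "\<And>n. closed (D n)" and convex: "\<And>n. convex (D n)" and ne: "\<And>n. D n \<noteq> {}"
    and bounded: "bounded (D 0)" and dec: "decseq D"
  shows "(\<Inter>n. D n) \<noteq> {}"
proof -
  define d where "d n = Inf (norm ` D n)" for n
  obtain b where b: "\<And>x n. x \<in> D n \<Longrightarrow> norm x \<le> b"
    using bounded decseqD[OF dec, of 0] unfolding bounded_iff by blast
  have bdd: "bdd_below (norm ` D n)" for n
    by (rule bdd_belowI[of _ 0]) auto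
  have d_le: "d n \<le> norm x" if "x \<in> D n" for x n
    unfolding d_def using that bdd by (intro cInf_lower) auto
  have d_nonneg: "d n \<ge> 0" for n
    unfolding d_def using ne by (intro cInf_greatest) auto
  have "incseq d"
    unfolding incseq_def d_def using ne bdd decseqD[OF dec]
    by (intro allI impI cInf_superset_mono image_mono) auto
  moreover have "d n \<le> b" for n
    using ne[of n] b d_le by (meson ex_in_conv order_trans)
  ultimately obtain l where l: "d \<longlonglongrightarrow> l"
    using incseq_convergent by (metis)
  have "\<exists>x\<in>D n. norm x \<le> d n + inverse (real (Suc n))" for n
  proof -
    have "Inf (norm ` D n) < d n + inverse (real (Suc n))"
      by (simp add: d_def)
    from cInf_lessD[OF _ this] show ?thesis
      using ne by fastforce
  qed
  then obtain x where x: "\<And>n. x n \<in> D n" "\<And>n. norm (x n) \<le> d n + inverse (real (Suc n))"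
    by metis
  define e where "e n = d n + inverse (real (Suc n))" for n
  have e: "e \<longlonglongrightarrow> l"
    unfolding e_def using tendsto_add[OF l LIMSEQ_inverse_real_of_nat] by simp
  have close: "(dist (x n) (x m))\<^sup>2 \<le> 2 * (e n)\<^sup>2 + 2 * (e m)\<^sup>2 - 4 * (d n)\<^sup>2" if "n \<le> m" for n m
  proof -
    have "x m \<in> D n"
      using x(1)[of m] decseqD[OF dec that] by blast
    then have "(1/2) *\<^sub>R x n + (1/2) *\<^sub>R x m \<in> D n"
      using convexD[OF convex[of n] x(1)[of n], of "x m" "1/2" "1/2"] by simp
    then have "d n \<le> norm ((1/2) *\<^sub>R x n + (1/2) *\<^sub>R x m)"
      by (rule d_le)
    then have 1: "(d n)\<^sup>2 \<le> (norm ((1/2) *\<^sub>R x n + (1/2) *\<^sub>R x m))\<^sup>2"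
      using d_nonneg by (intro power_mono)
    have 2: "(dist (x n) (x m))\<^sup>2 + 4 * (norm ((1/2) *\<^sub>R x n + (1/2) *\<^sub>R x m))\<^sup>2
        = 2 * (norm (x n))\<^sup>2 + 2 * (norm (x m))\<^sup>2"
      unfolding dist_norm power2_norm_eq_inner by (simp add: inner_simps inner_commute)
    have 3: "(norm (x n))\<^sup>2 \<le> (e n)\<^sup>2" "(norm (x m))\<^sup>2 \<le> (e m)\<^sup>2"
      using x(2) by (auto intro!: power_mono simp: e_def)
    show ?thesis
      using 1 2 3 by linarith
  qed
  have "Cauchy x"
  proof (rule metric_CauchyI)
    fix r :: real assume r: "0 < r"
    have "(\<lambda>n. (e n)\<^sup>2) \<longlonglongrightarrow> l\<^sup>2" "(\<lambda>n. (d n)\<^sup>2) \<longlonglongrightarrow> l\<^sup>2"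
      using e l by (auto intro!: tendsto_intros)
    then have "\<forall>\<^sub>F n in sequentially. \<bar>(e n)\<^sup>2 - l\<^sup>2\<bar> < r\<^sup>2 / 10 \<and> \<bar>(d n)\<^sup>2 - l\<^sup>2\<bar> < r\<^sup>2 / 10"
      using r unfolding tendsto_iff dist_real_def by (intro eventually_conj) (blast intro: divide_pos_pos zero_less_power zero_less_numeral)+
    then obtain M where M: "\<And>n. n \<ge> M \<Longrightarrow> \<bar>(e n)\<^sup>2 - l\<^sup>2\<bar> < r\<^sup>2 / 10 \<and> \<bar>(d n)\<^sup>2 - l\<^sup>2\<bar> < r\<^sup>2 / 10"
      by (auto simp: eventually_sequentially)
    have *: "dist (x n) (x m) < r" if "M \<le> n" "n \<le> m" for n m
    proof -
      have "(dist (x n) (x m))\<^sup>2 < r\<^sup>2"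
        using close[OF that(2)] M[of n] M[of m] that by linarith
      then show ?thesis
        using r by (simp add: power2_less_imp_less)
    qed
    show "\<exists>M. \<forall>m\<ge>M. \<forall>n\<ge>M. dist (x m) (x n) < r"
      using * by (metis dist_commute nle_le)
  qed
  then obtain y where y: "x \<longlonglongrightarrow> y"
    using Cauchy_convergent_iff convergent_def by blast
  have "y \<in> D n" for n
  proof (rule closed_sequentially[OF closed[of n], of "\<lambda>k. x (n + k)"])
    show "x (n + k) \<in> D n" for k
      using x(1) decseqD[OF dec] by (meson le_add1 subsetD)
    show "(\<lambda>k. x (n + k)) \<longlonglongrightarrow> y"
      using LIMSEQ_ignore_initial_segment[OF y, of n] by (simp add: add.commute)
  qed
  then show ?thesis
    by blast
qed

text \<open>The points of \<open>C\<close> that are nearest up to \<open>1 / (n + 1)\<close> form a nested family to which the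
  intersection lemma applies.\<close>
lemma exists_nearest_point:
  fixes C :: "'a :: {real_inner, complete_space} set"
  assumes "closed C" "convex C" "C \<noteq> {}"
  obtains p where "p \<in> C" "\<And>y. y \<in> C \<Longrightarrow> dist x p \<le> dist x y"
proof -
  define D where "D n = C \<inter> cball x (infdist x C + inverse (real (Suc n)))" for n
  have "(\<Inter>n. D n) \<noteq> {}"
  proof (rule nested_bounded_closed_convex_Inter_nonempty)
    fix n
    have "Inf (dist x ` C) < infdist x C + inverse (real (Suc n))"
      using assms(3) by (simp add: infdist_def)
    from cInf_lessD[OF _ this] obtain y where "y \<in> C" "dist x y < infdist x C + inverse (real (Suc n))"
      using assms(3) by blast
    then have "y \<in> D n"
      by (simp add: D_def)
    then show "D n \<noteq> {}"
      by blast
  next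
    show "decseq D"
      unfolding decseq_def D_def
    proof (intro allI impI Int_mono order_refl subset_cball add_left_mono)
      fix m n :: nat assume "m \<le> n"
      then show "inverse (real (Suc n)) \<le> inverse (real (Suc m))"
        by (intro le_imp_inverse_le) auto
    qed
  qed (use assms in \<open>auto simp: D_def intro: closed_Int convex_Int bounded_Int\<close>)
  then obtain p where p: "\<And>n. p \<in> D n"
    by blast
  have "dist x p \<le> infdist x C"
  proof (rule LIMSEQ_le_const)
    show "(\<lambda>n. infdist x C + inverse (real (Suc n))) \<longlonglongrightarrow> infdist x C"
      using tendsto_add[OF tendsto_const LIMSEQ_inverse_real_of_nat] by simp
    show "\<exists>N. \<forall>n\<ge>N. dist x p \<le> infdist x C + inverse (real (Suc n))"
      using p by (auto simp: D_def)
  qed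
  then show ?thesis
    using p[of 0] by (intro that[of p]) (auto simp: D_def intro: order_trans infdist_le)
qed

lemma exists_orthogonal_vector:
  fixes S :: "'a :: {real_inner, complete_space} set"
  assumes "closed S" "subspace S" "x \<notin> S"
  obtains v where "\<And>y. y \<in> S \<Longrightarrow> inner y v = 0" "inner x v > 0"
proof -
  obtain p where p: "p \<in> S" "\<And>y. y \<in> S \<Longrightarrow> dist x p \<le> dist x y"
    using exists_nearest_point[of S x] assms subspace_imp_convex subspace_0 by blast
  define v where "v = x - p"
  have "v \<noteq> 0"
    using p assms by (auto simp: v_def)
  have orth: "inner y v = 0" if y: "y \<in> S" for y
  proof (rule ccontr)
    assume nz: "inner y v \<noteq> 0"
    then have "y \<noteq> 0"
      by auto
    define t where "t = inner y v / inner y y"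
    have "p + t *\<^sub>R y \<in> S"
      using p y assms by (simp add: subspace_add subspace_scale)
    then have "(norm v)\<^sup>2 \<le> (norm (v - t *\<^sub>R y))\<^sup>2"
      using p(2) by (intro power_mono) (auto simp: dist_norm v_def algebra_simps)
    then have "2 * t * inner y v \<le> t\<^sup>2 * inner y y"
      unfolding power2_norm_eq_inner
      by (simp add: inner_simps inner_commute power2_eq_square algebra_simps)
    then have "(inner y v)\<^sup>2 / inner y y \<le> 0"
      using \<open>y \<noteq> 0\<close> by (simp add: t_def power2_eq_square field_simps)
    moreover have "(inner y v)\<^sup>2 / inner y y > 0"
      using nz \<open>y \<noteq> 0\<close> by simp
    ultimately show False
      by simp
  qed
  have "inner x v = inner v v"
    using orth[OF p(1)] by (simp add: v_def inner_simps)
  then show ?thesis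
    using orth \<open>v \<noteq> 0\<close> by (intro that[of v]) auto
qed

lemma subspace_closure:
  fixes S :: "'a :: real_normed_vector set"
  assumes S: "subspace S"
  shows "subspace (closure S)"
  unfolding subspace_def
proof (intro conjI allI ballI)
  show "0 \<in> closure S"
    using S closure_subset by (auto dest: subspace_0)
next
  fix x y assume "x \<in> closure S" "y \<in> closure S"
  then obtain f g where "\<And>n. f n \<in> S" "f \<longlonglongrightarrow> x" "\<And>n. g n \<in> S" "g \<longlonglongrightarrow> y"
    by (auto simp: closure_sequential)
  then show "x + y \<in> closure S"
    using S unfolding closure_sequential
    by (intro exI[of _ "\<lambda>n. f n + g n"]) (auto intro: subspace_add tendsto_add)
next
  fix c x assume "x \<in> closure S"
  then obtain f where "\<And>n. f n \<in> S" "f \<longlonglongrightarrow> x"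
    by (auto simp: closure_sequential)
  then show "c *\<^sub>R x \<in> closure S"
    using S unfolding closure_sequential
    by (intro exI[of _ "\<lambda>n. c *\<^sub>R f n"]) (auto intro: subspace_scale tendsto_scaleR)
qed

text \<open>A complex span is in particular a real subspace, so that the real projection theorem applies.\<close>
lemma separate_from_closure_cspan:
  fixes S :: "'a :: complex_hilbert_space set"
  assumes "x \<notin> closure (cspan S)"
  obtains v where "\<And>y. y \<in> S \<Longrightarrow> inner y v = 0" "inner x v > 0"
proof -
  have "subspace (cspan S)"
    unfolding subspace_def scaleR_scaleC
    by (simp add: complex_vector.span_zero complex_vector.span_add complex_vector.span_scale)
  then have "subspace (closure (cspan S))"
    by (rule subspace_closure)
  then obtain v where v: "\<And>y. y \<in> closure (cspan S) \<Longrightarrow> inner y v = 0" "inner x v > 0"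
    using exists_orthogonal_vector assms by (metis closed_closure)
  show ?thesis
    using v complex_vector.span_base closure_subset by (intro that[of v]) blast+
qed

section \<open>Inclusions between families of sets of natural numbers\<close>

text \<open>A bounded set misses the differences of the multiples of a large number.\<close>
lemma meets_Delta_sets_infinite:
  assumes "\<And>B. B \<in> Delta_sets \<Longrightarrow> A \<inter> B \<noteq> {}"
  shows "infinite A"
proof
  assume "finite A"
  then obtain k where k: "\<And>n. n \<in> A \<Longrightarrow> n < k"
    using finite_nat_set_iff_bounded by auto
  define B where "B = range (\<lambda>n. n * Suc k)"
  have "infinite B"
    unfolding B_def by (intro range_inj_infinite) (simp add: inj_on_def del: mult_Suc_right)
  then have "{b - b' | b b'. b \<in> B \<and> b' \<in> B \<and> b' < b} \<in> Delta_sets"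
    unfolding Delta_sets_def by blast
  from assms[OF this] obtain m n where mn: "m * Suc k - n * Suc k \<in> A" "n * Suc k < m * Suc k"
    unfolding B_def by auto
  then have "n < m"
    by (simp del: mult_Suc_right)
  then have "1 * Suc k \<le> (m - n) * Suc k"
    by (intro mult_le_mono1) simp
  also have "\<dots> = m * Suc k - n * Suc k"
    by (rule diff_mult_distrib)
  finally show False
    using k[OF mn(1)] by simp
qed

text \<open>The differences of partial sums of a sequence are sums of blocks of that sequence.\<close>
lemma IP_sets_subset_Delta_sets: "IP_sets \<subseteq> Delta_sets"
proof
  fix A assume "A \<in> IP_sets"
  then obtain x :: "nat \<Rightarrow> nat" where x: "strict_mono x" "{\<Sum>n\<in>F. x n | F. finite F \<and> F \<noteq> {}} \<subseteq> A"
    unfolding IP_sets_def by blast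
  define s where "s n = (\<Sum>i\<le>n. x i)" for n
  have "strict_mono s"
  proof (rule strict_monoI_Suc)
    fix n
    have "x 0 < x (Suc n)"
      using x(1) by (simp add: strict_mono_def)
    then show "s n < s (Suc n)"
      by (simp add: s_def)
  qed
  then have inf: "infinite (range s)"
    by (intro range_inj_infinite) (auto dest: strict_mono_imp_inj_on)
  have "s m - s n \<in> A" if "s n < s m" for m n
  proof -
    have nm: "n < m"
      using that \<open>strict_mono s\<close> by (simp add: strict_mono_less)
    then have "s m = s n + (\<Sum>i\<in>{n<..m}. x i)"
      unfolding s_def by (subst sum.union_disjoint[symmetric]) (auto intro!: sum.cong)
    then have "s m - s n = (\<Sum>i\<in>{n<..m}. x i)"
      by simp
    also have "\<dots> \<in> {\<Sum>n\<in>F. x n | F. finite F \<and> F \<noteq> {}}"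
      using nm by (intro CollectI exI[of _ "{n<..m}"]) auto
    finally show ?thesis
      using x(2) by blast
  qed
  then show "A \<in> Delta_sets"
    using inf unfolding Delta_sets_def by blast
qed

text \<open>The complement of a set that is not syndetic contains arbitrarily long intervals, arbitrarily far
  out. If each new generator of an IP-set is the left end of such an interval, of length at least the
  sum of the earlier generators, then all the finite sums stay in the complement.\<close>
lemma dual_IP_sets_subset_syndetic_sets: "dual_family IP_sets \<subseteq> syndetic_sets"
proof (rule subsetI, rule ccontr)
  fix A assume A: "A \<in> dual_family IP_sets" "A \<notin> syndetic_sets"
  have gaps: "\<exists>y>l. {y..y + m} \<inter> A = {}" for l m
  proof -
    have "\<exists>x. {x..x + (Suc l + m)} \<inter> A = {}"
    proof (rule ccontr)
      assume "\<nexists>x. {x..x + (Suc l + m)} \<inter> A = {}"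
      then have "A \<in> syndetic_sets"
        unfolding syndetic_sets_def by (intro CollectI exI[of _ "Suc l + m"] conjI allI) auto
      then show False
        using A(2) by simp
    qed
    then obtain x where "{x..x + (Suc l + m)} \<inter> A = {}"
      by blast
    then have "{x + Suc l..x + Suc l + m} \<inter> A = {}"
      by (auto simp: disjoint_iff)
    then show ?thesis
      by (intro exI[of _ "x + Suc l"]) auto
  qed
  define next_gap where "next_gap = (\<lambda>s l. SOME y. y > l \<and> {y..y + s} \<inter> A = {})"
  have next_gap: "next_gap s l > l \<and> {next_gap s l..next_gap s l + s} \<inter> A = {}" for s l
    unfolding next_gap_def by (rule someI_ex) (use gaps in blast)
  \<comment> \<open>The state consists of the generator just chosen and the sum of all generators so far.\<close>
  define p where "p = rec_nat (next_gap 0 0, next_gap 0 0)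
    (\<lambda>_ (l, s). (next_gap s l, s + next_gap s l))"
  define x where "x n = fst (p n)" for n
  have x_Suc: "x (Suc n) = next_gap (snd (p n)) (x n)" for n
    by (simp add: x_def p_def split: prod.split)
  have snd_p: "snd (p n) = (\<Sum>i\<le>n. x i)" for n
  proof (induction n)
    case 0
    then show ?case
      by (simp add: p_def x_def)
  next
    case (Suc n)
    have "snd (p (Suc n)) = snd (p n) + x (Suc n)"
      by (simp add: x_def p_def split: prod.split)
    then show ?case
      using Suc by simp
  qed
  have "strict_mono x"
    using next_gap by (intro strict_monoI_Suc) (simp add: x_Suc)
  have "(\<Sum>n\<in>F. x n) \<notin> A" if F: "finite F" "F \<noteq> {}" for F
  proof -
    define m where "m = Max F"
    have m: "m \<in> F" "F - {m} \<subseteq> {..<m}"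
      using F by (auto simp: m_def intro: le_neq_trans)
    have sum: "(\<Sum>n\<in>F. x n) = x m + (\<Sum>n\<in>F - {m}. x n)"
      using F m by (simp add: sum.remove)
    show ?thesis
    proof (cases m)
      case 0
      then have "F - {m} = {}"
        using m by auto
      then have "(\<Sum>n\<in>F. x n) = x 0"
        unfolding sum using 0 by (simp only: sum.empty add_0_right)
      then show ?thesis
        using next_gap[of 0 0] by (auto simp: x_def p_def)
    next
      case (Suc k)
      have "(\<Sum>n\<in>F - {m}. x n) \<le> (\<Sum>n\<le>k. x n)"
        using m Suc by (intro sum_mono2) auto
      then have "(\<Sum>n\<in>F. x n) \<in> {x m..x m + snd (p k)}"
        using sum by (simp add: snd_p)
      then show ?thesis
        using next_gap[where s="snd (p k)" and l="x k"] by (auto simp: Suc x_Suc)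
    qed
  qed
  then have "A \<inter> {\<Sum>n\<in>F. x n | F. finite F \<and> F \<noteq> {}} = {}"
    by blast
  moreover have "{\<Sum>n\<in>F. x n | F. finite F \<and> F \<noteq> {}} \<in> IP_sets"
    unfolding IP_sets_def using \<open>strict_mono x\<close> by blast
  ultimately show False
    using A(1) unfolding dual_family_def by blast
qed

lemma card_syndetic_ge:
  fixes A :: "nat set"
  assumes "\<And>x. {x..x + m} \<inter> A \<noteq> {}"
  shows "k \<le> card (A \<inter> {..<k * Suc m})"
proof (induction k)
  case (Suc k)
  obtain a where a: "a \<in> A" "k * Suc m \<le> a" "a \<le> k * Suc m + m"
    using assms[of "k * Suc m"] by auto
  have "Suc k \<le> card (insert a (A \<inter> {..<k * Suc m}))"
    using Suc a by (subst card_insert_disjoint) auto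
  also have "\<dots> \<le> card (A \<inter> {..<Suc k * Suc m})"
    using a by (intro card_mono) auto
  finally show ?case .
qed simp

lemma lower_density_pos_if_syndetic:
  assumes "A \<in> syndetic_sets"
  shows "lower_density A > 0"
proof -
  obtain m where m: "\<And>x. {x..x + m} \<inter> A \<noteq> {}"
    using assms unfolding syndetic_sets_def by blast
  have "1 / (2 * real (Suc m)) \<le> real (card (A \<inter> {0..N})) / real (N + 1)" if "N \<ge> m" for N
  proof -
    define k where "k = (N + 1) div Suc m"
    have k: "k \<ge> 1" "k * Suc m \<le> N + 1"
      using that by (auto simp: k_def div_greater_zero_iff Suc_le_eq simp del: mult_Suc_right)
    have "N + 1 < Suc k * Suc m"
      unfolding k_def by (metis dividend_less_div_times zero_less_Suc mult_Suc)
    also have "\<dots> \<le> 2 * k * Suc m"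
      using k(1) by (intro mult_le_mono1) simp
    also have "\<dots> \<le> 2 * card (A \<inter> {0..N}) * Suc m"
    proof (intro mult_le_mono1 mult_le_mono2)
      show "k \<le> card (A \<inter> {0..N})"
        using k(2) by (intro order_trans[OF card_syndetic_ge[OF m] card_mono]) auto
    qed
    finally have "real (N + 1) \<le> real (2 * card (A \<inter> {0..N}) * Suc m)"
      by (intro of_nat_mono) simp
    also have "\<dots> = real (card (A \<inter> {0..N})) * (2 * real (Suc m))"
      by (simp only: of_nat_mult of_nat_numeral mult_ac)
    finally have le: "real (N + 1) \<le> real (card (A \<inter> {0..N})) * (2 * real (Suc m))" .
    have "1 / a \<le> c / b" if "0 < a" "0 < b" "b \<le> c * a" for a b c :: real
      using that by (simp add: field_simps)
    then show ?thesis
      using le by simp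
  qed
  then have "ereal (1 / (2 * real (Suc m))) \<le> lower_density A"
    unfolding lower_density_def
    by (intro Liminf_bounded) (auto simp: eventually_sequentially simp del: of_nat_Suc intro!: exI[of _ m])
  moreover have "0 < ereal (1 / (2 * real (Suc m)))"
    by simp
  ultimately show ?thesis
    by (rule less_le_trans[rotated])
qed

lemma lower_density_le_upper_density: "lower_density A \<le> upper_density A"
  unfolding lower_density_def upper_density_def by (intro Liminf_le_Limsup) simp

lemma upper_density_le_upper_Banach_density: "upper_density A \<le> upper_Banach_density A"
  unfolding upper_density_def upper_Banach_density_def
proof (intro Limsup_mono always_eventually allI)
  fix N
  have "real (card (A \<inter> {0..0 + N})) / real (N + 1)
      \<le> Max (range (\<lambda>m. real (card (A \<inter> {m..m + N})) / real (N + 1)))"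
    by (rule Max_ge[OF finite_range_window_density]) (rule rangeI)
  then show "ereal (real (card (A \<inter> {0..N})) / real (N + 1))
      \<le> ereal (Max (range (\<lambda>m. real (card (A \<inter> {m..m + N})) / real (N + 1))))"
    by simp
qed

lemma upper_Banach_density_posE:
  assumes "upper_Banach_density A > 0"
  obtains d where "d > 0"
    "\<And>K. \<exists>N\<ge>K. \<exists>m. d * real (N + 1) < real (card (A \<inter> {m..m + N}))"
proof -
  define f where "f N = Max (range (\<lambda>m. real (card (A \<inter> {m..m + N})) / real (N + 1)))" for N
  obtain d where d: "0 < ereal d" "ereal d < limsup (\<lambda>N. ereal (f N))"
    using assms ereal_dense2 unfolding upper_Banach_density_def f_def by blast
  have "\<exists>N\<ge>K. \<exists>m. d * real (N + 1) < real (card (A \<inter> {m..m + N}))" for K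
  proof -
    have "\<exists>N\<ge>K. d < f N"
    proof (rule ccontr)
      assume "\<not> (\<exists>N\<ge>K. d < f N)"
      then have "limsup (\<lambda>N. ereal (f N)) \<le> ereal d"
        by (intro Limsup_bounded) (auto simp: eventually_sequentially not_less intro!: exI[of _ K])
      then show False
        using d by simp
    qed
    then obtain N where N: "N \<ge> K" "d < f N"
      by blast
    have "f N \<in> range (\<lambda>m. real (card (A \<inter> {m..m + N})) / real (N + 1))"
      unfolding f_def by (rule Max_in[OF finite_range_window_density]) simp
    then show ?thesis
      using N by (force simp: field_simps)
  qed
  then show ?thesis
    using d(1) by (intro that[of d]) auto
qed

section \<open>Inclusions between sets of recurrent points\<close>

lemma recurrent_points_mono: "\<F> \<subseteq> \<G> \<Longrightarrow> recurrent_points \<F> T \<subseteq> recurrent_points \<G> T"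
  unfolding recurrent_points_def by blast

lemma Delta_star_Rec_subset_IP_star_Rec: "Delta_star_Rec T \<subseteq> IP_star_Rec T"
  unfolding Delta_star_Rec_def IP_star_Rec_def
  using IP_sets_subset_Delta_sets by (intro recurrent_points_mono) (auto simp: dual_family_def)

lemma IP_star_Rec_subset_URec: "IP_star_Rec T \<subseteq> URec T"
  unfolding IP_star_Rec_def URec_def
  by (intro recurrent_points_mono dual_IP_sets_subset_syndetic_sets)

text \<open>The orbit returns to a ball at bounded gaps \<open>m\<close>, and between two returns its norm can grow by at
  most a factor \<open>L ^ m\<close>.\<close>
lemma URec_subset_bounded_orbit_points:
  fixes T :: "'a :: real_normed_vector \<Rightarrow> 'a"
  assumes "bounded_linear T"
  shows "URec T \<subseteq> bounded_orbit_points T"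
proof
  fix x assume "x \<in> URec T"
  then have "return_set T x (ball x 1) \<in> syndetic_sets"
    unfolding URec_def recurrent_points_def by auto
  then obtain m where m: "\<And>n. {n..n + m} \<inter> return_set T x (ball x 1) \<noteq> {}"
    unfolding syndetic_sets_def by blast
  obtain K where K: "\<And>y. norm (T y) \<le> norm y * K" "K \<ge> 0"
    using bounded_linear.nonneg_bounded[OF assms] by blast
  define L where "L = max 1 K"
  have L: "norm ((T ^^ j) y) \<le> L ^ j * norm y" for j y
  proof (induction j)
    case (Suc j)
    have "norm ((T ^^ Suc j) y) \<le> norm ((T ^^ j) y) * L"
      using K(1)[of "(T ^^ j) y"] by (simp add: L_def) (smt (verit) mult_left_mono norm_ge_zero)
    also have "\<dots> \<le> L ^ j * norm y * L"
      using Suc by (intro mult_right_mono) (auto simp: L_def)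
    finally show ?case
      by (simp add: mult_ac)
  qed simp
  define C where "C = (\<Sum>j\<le>m. norm ((T ^^ j) x)) + L ^ m * (norm x + 1)"
  have "norm ((T ^^ n) x) \<le> C" for n
  proof (cases "n \<le> m")
    case True
    then have "norm ((T ^^ n) x) \<le> (\<Sum>j\<le>m. norm ((T ^^ j) x))"
      by (intro member_le_sum) auto
    then show ?thesis
      unfolding C_def L_def by (smt (verit) mult_nonneg_nonneg norm_ge_zero zero_le_power)
  next
    case False
    obtain k where k: "n - m \<le> k" "k \<le> n - m + m" "dist x ((T ^^ k) x) < 1"
      using m[of "n - m"] by (auto simp: return_set_def)
    define y where "y = (T ^^ k) x"
    have "n = (n - k) + k"
      using k False by simp
    then have "(T ^^ n) x = (T ^^ (n - k)) y"
      unfolding y_def by (metis comp_apply funpow_add)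
    also have "norm \<dots> \<le> L ^ (n - k) * norm y"
      by (rule L)
    also have "\<dots> \<le> L ^ m * (norm x + 1)"
    proof (intro mult_mono power_increasing)
      show "norm y \<le> norm x + 1"
        using k(3) norm_triangle_ineq2[of y x] by (simp add: y_def dist_norm norm_minus_commute)
    qed (use k False in \<open>auto simp: L_def\<close>)
    finally show ?thesis
      unfolding C_def by (smt (verit) norm_ge_zero sum_nonneg)
  qed
  then show "x \<in> bounded_orbit_points T"
    unfolding bounded_orbit_points_def bounded_iff by blast
qed

lemma URec_subset_FRec_bo:
  fixes T :: "'a :: real_normed_vector \<Rightarrow> 'a"
  assumes "bounded_linear T"
  shows "URec T \<subseteq> FRec_bo T"
proof -
  have "URec T \<subseteq> FRec T"
    unfolding URec_def FRec_def
    by (intro recurrent_points_mono) (auto intro: lower_density_pos_if_syndetic)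
  then show ?thesis
    using URec_subset_bounded_orbit_points[OF assms] unfolding FRec_bo_def by blast
qed

lemma FRec_bo_subset_UFRec_bo: "FRec_bo T \<subseteq> UFRec_bo T"
proof -
  have "FRec T \<subseteq> UFRec T"
    unfolding FRec_def UFRec_def
    by (intro recurrent_points_mono) (auto intro: less_le_trans lower_density_le_upper_density)
  then show ?thesis
    unfolding FRec_bo_def UFRec_bo_def by blast
qed

lemma UFRec_bo_subset_RRec_bo: "UFRec_bo T \<subseteq> RRec_bo T"
proof -
  have "UFRec T \<subseteq> RRec T"
    unfolding UFRec_def RRec_def
    by (intro recurrent_points_mono) (auto intro: less_le_trans upper_density_le_upper_Banach_density)
  then show ?thesis
    unfolding UFRec_bo_def RRec_bo_def by blast
qed

section \<open>Eigenvectors are recurrent\<close>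

text \<open>The return along differences is demanded for all late pairs of a subsequence of any given sequence of
  times, and not just for one pair: in this form it passes to sums, by taking a subsequence of a
  subsequence.\<close>
definition orbit_differences_return :: "('a :: real_normed_vector \<Rightarrow> 'a) \<Rightarrow> 'a \<Rightarrow> bool" where
  "orbit_differences_return T x \<longleftrightarrow> (\<forall>b :: nat \<Rightarrow> nat. strict_mono b \<longrightarrow>
     (\<exists>r :: nat \<Rightarrow> nat. strict_mono r \<and> (\<forall>e>0. \<exists>K. \<forall>j\<ge>K. \<forall>k\<ge>j. norm ((T ^^ (b (r k) - b (r j))) x - x) < e)))"

lemma bounded_clinear_funpow:
  fixes T :: "'a :: complex_inner \<Rightarrow> 'a"
  assumes "bounded_clinear T"
  shows "(T ^^ n) (x + y) = (T ^^ n) x + (T ^^ n) y" "(T ^^ n) (c *\<^sub>C x) = c *\<^sub>C (T ^^ n) x"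
    "(T ^^ n) 0 = 0"
proof -
  interpret T: bounded_linear T
    using assms by (simp add: bounded_clinear_def)
  show "(T ^^ n) (x + y) = (T ^^ n) x + (T ^^ n) y" "(T ^^ n) (c *\<^sub>C x) = c *\<^sub>C (T ^^ n) x"
    "(T ^^ n) 0 = 0"
    using assms by (induction n) (simp_all add: T.add bounded_clinear_def T.zero)
qed

lemma unimodular_eigenvector_funpow:
  fixes T :: "'a :: complex_inner \<Rightarrow> 'a"
  assumes "bounded_clinear T" "T x = l *\<^sub>C x"
  shows "(T ^^ n) x = (l ^ n) *\<^sub>C x"
proof (induction n)
  case (Suc n)
  then show ?case
    using assms by (simp add: bounded_clinear_def scaleC_scaleC mult.commute)
qed (simp add: scaleC_one)

text \<open>The powers \<open>l ^ b n\<close> live on the compact circle. Multiplication by \<open>l ^ b (r j)\<close> is isometric, so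
  the Cauchy property of a convergent subsequence is a statement about exponent differences.\<close>
lemma orbit_differences_return_eigenvector:
  fixes T :: "'a :: complex_inner \<Rightarrow> 'a"
  assumes T: "bounded_clinear T" and l: "cmod l = 1" "T x = l *\<^sub>C x"
  shows "orbit_differences_return T x"
  unfolding orbit_differences_return_def
proof (intro allI impI)
  fix b :: "nat \<Rightarrow> nat" assume b: "strict_mono b"
  have "compact (sphere (0 :: complex) 1)"
    by simp
  moreover have "\<forall>n. l ^ b n \<in> sphere 0 1"
    using l(1) by (simp add: norm_power)
  ultimately obtain z r where r: "strict_mono r" "((\<lambda>n. l ^ b n) \<circ> r) \<longlonglongrightarrow> z"
    unfolding compact_def by metis
  have "\<exists>K. \<forall>j\<ge>K. \<forall>k\<ge>j. norm ((T ^^ (b (r k) - b (r j))) x - x) < e" if "e > 0" for e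
  proof -
    define e' where "e' = e / (norm x + 1)"
    have nx: "norm x + 1 > 0"
      by (simp add: add_nonneg_pos)
    have e': "e' > 0"
      using that nx by (simp add: e'_def)
    have "Cauchy ((\<lambda>n. l ^ b n) \<circ> r)"
      using r(2) by (rule LIMSEQ_imp_Cauchy)
    from metric_CauchyD[OF this e'] obtain K where
      K: "\<And>j k. j \<ge> K \<Longrightarrow> k \<ge> K \<Longrightarrow> cmod (l ^ b (r k) - l ^ b (r j)) < e'"
      by (auto simp: dist_norm)
    have "norm ((T ^^ (b (r k) - b (r j))) x - x) < e" if "j \<ge> K" "k \<ge> j" for j k
    proof -
      have "b (r j) \<le> b (r k)"
        using b r(1) that by (simp add: strict_mono_less_eq)
      then have "l ^ b (r k) - l ^ b (r j) = l ^ b (r j) * (l ^ (b (r k) - b (r j)) - 1)"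
        by (simp add: right_diff_distrib flip: power_add)
      then have "cmod (l ^ (b (r k) - b (r j)) - 1) < e'"
        using K[of j k] that l(1) by (simp add: norm_mult norm_power)
      moreover have "(T ^^ (b (r k) - b (r j))) x - x = (l ^ (b (r k) - b (r j)) - 1) *\<^sub>C x"
        by (simp add: unimodular_eigenvector_funpow[OF T l(2)] complex_vector.scale_left_diff_distrib scaleC_one)
      ultimately have "norm ((T ^^ (b (r k) - b (r j))) x - x) \<le> e' * norm x"
        by (simp add: norm_scaleC mult_right_mono)
      also have "\<dots> < e' * (norm x + 1)"
        using e' by simp
      also have "\<dots> = e"
        using nx by (simp add: e'_def)
      finally show ?thesis .
    qed
    then show ?thesis
      by blast
  qed
  then show "\<exists>r :: nat \<Rightarrow> nat. strict_mono r \<and> (\<forall>e>0. \<exists>K. \<forall>j\<ge>K. \<forall>k\<ge>j. norm ((T ^^ (b (r k) - b (r j))) x - x) < e)"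
    using r(1) by blast
qed

lemma orbit_differences_return_add:
  fixes T :: "'a :: complex_inner \<Rightarrow> 'a"
  assumes T: "bounded_clinear T" and x: "orbit_differences_return T x" and y: "orbit_differences_return T y"
  shows "orbit_differences_return T (x + y)"
  unfolding orbit_differences_return_def
proof (intro allI impI)
  fix b :: "nat \<Rightarrow> nat" assume b: "strict_mono b"
  obtain r :: "nat \<Rightarrow> nat" where r: "strict_mono r"
    "\<And>e. e > 0 \<Longrightarrow> \<exists>K. \<forall>j\<ge>K. \<forall>k\<ge>j. norm ((T ^^ (b (r k) - b (r j))) x - x) < e"
    using x b unfolding orbit_differences_return_def by blast
  have "strict_mono (\<lambda>n. b (r n))"
    using b r(1) by (simp add: strict_mono_def)
  then obtain s :: "nat \<Rightarrow> nat" where s: "strict_mono s"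
    "\<And>e. e > 0 \<Longrightarrow> \<exists>K. \<forall>j\<ge>K. \<forall>k\<ge>j. norm ((T ^^ (b (r (s k)) - b (r (s j)))) y - y) < e"
    using y unfolding orbit_differences_return_def by blast
  have "\<exists>K. \<forall>j\<ge>K. \<forall>k\<ge>j. norm ((T ^^ (b (r (s k)) - b (r (s j)))) (x + y) - (x + y)) < e" if "e > 0" for e
  proof -
    have "e / 2 > 0"
      using that by simp
    then obtain K1 K2 where K1: "\<And>j k. j \<ge> K1 \<Longrightarrow> k \<ge> j \<Longrightarrow> norm ((T ^^ (b (r k) - b (r j))) x - x) < e / 2"
      and K2: "\<And>j k. j \<ge> K2 \<Longrightarrow> k \<ge> j \<Longrightarrow> norm ((T ^^ (b (r (s k)) - b (r (s j)))) y - y) < e / 2"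
      using r(2)[of "e / 2"] s(2)[of "e / 2"] by metis
    have "norm ((T ^^ (b (r (s k)) - b (r (s j)))) (x + y) - (x + y)) < e" if jk: "j \<ge> max K1 K2" "k \<ge> j" for j k
    proof -
      define n where "n = b (r (s k)) - b (r (s j))"
      have "s j \<ge> K1" "s k \<ge> s j"
        using jk seq_suble[OF s(1), of j] s(1) by (auto simp: strict_mono_less_eq)
      then have less: "norm ((T ^^ n) x - x) < e / 2" "norm ((T ^^ n) y - y) < e / 2"
        using K1 K2 jk by (auto simp: n_def)
      have "(T ^^ n) (x + y) - (x + y) = ((T ^^ n) x - x) + ((T ^^ n) y - y)"
        by (simp add: bounded_clinear_funpow[OF T])
      also have "norm \<dots> < e"
        using norm_triangle_ineq[of "(T ^^ n) x - x" "(T ^^ n) y - y"] less by linarith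
      finally show ?thesis
        by (simp add: n_def)
    qed
    then show ?thesis
      by blast
  qed
  moreover have "strict_mono (\<lambda>n. r (s n))"
    using r(1) s(1) by (simp add: strict_mono_def)
  ultimately show "\<exists>r :: nat \<Rightarrow> nat. strict_mono r \<and> (\<forall>e>0. \<exists>K. \<forall>j\<ge>K. \<forall>k\<ge>j. norm ((T ^^ (b (r k) - b (r j))) (x + y) - (x + y)) < e)"
    by (intro exI[of _ "\<lambda>n. r (s n)"]) auto
qed

lemma unimodular_eigenvectors_scaleCE:
  assumes "bounded_clinear T" "x \<in> unimodular_eigenvectors T"
  obtains l where "cmod l = 1" "T (c *\<^sub>C x) = l *\<^sub>C (c *\<^sub>C x)"
proof -
  obtain l where "cmod l = 1" "T x = l *\<^sub>C x"
    using assms(2) unfolding unimodular_eigenvectors_def by auto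
  then show ?thesis
    using assms(1) by (intro that[of l]) (simp_all add: bounded_clinear_def scaleC_scaleC mult.commute)
qed

lemma cspan_subset_Delta_star_Rec:
  fixes T :: "'a :: complex_inner \<Rightarrow> 'a"
  assumes T: "bounded_clinear T"
  shows "cspan (unimodular_eigenvectors T) \<subseteq> Delta_star_Rec T"
proof
  fix x assume "x \<in> cspan (unimodular_eigenvectors T)"
  then have x: "orbit_differences_return T x"
  proof (induction rule: complex_vector.span_induct_alt)
    case base
    show ?case
      by (rule orbit_differences_return_eigenvector[OF T, of 1])
         (use bounded_clinear_funpow(3)[OF T, of 1] in \<open>simp_all add: scaleC_one\<close>)
  next
    case (step c x y)
    obtain l where "cmod l = 1" "T (c *\<^sub>C x) = l *\<^sub>C (c *\<^sub>C x)"
      by (rule unimodular_eigenvectors_scaleCE[OF T step(1)])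
    then show ?case
      using step(2) by (intro orbit_differences_return_add[OF T]) (rule orbit_differences_return_eigenvector[OF T])
  qed
  show "x \<in> Delta_star_Rec T"
    unfolding Delta_star_Rec_def recurrent_points_def
  proof (intro CollectI allI impI)
    fix U assume "x \<in> interior U"
    then obtain e where e: "e > 0" "ball x e \<subseteq> U"
      by (auto simp: mem_interior)
    have meets: "return_set T x U \<inter> B \<noteq> {}" if B: "B \<in> Delta_sets" for B
    proof -
      obtain D :: "nat set" where D: "infinite D" "{b - b' | b b'. b \<in> D \<and> b' \<in> D \<and> b' < b} \<subseteq> B"
        using B unfolding Delta_sets_def by blast
      define b where "b = enumerate D"
      have b: "strict_mono b" "\<And>n. b n \<in> D"
        unfolding b_def using D(1) by (auto intro: strict_mono_enumerate enumerate_in_set)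
      obtain r :: "nat \<Rightarrow> nat" and K where r: "strict_mono r"
        "\<And>j k. j \<ge> K \<Longrightarrow> k \<ge> j \<Longrightarrow> norm ((T ^^ (b (r k) - b (r j))) x - x) < e"
        using x b(1) e(1) unfolding orbit_differences_return_def by meson
      have "b (r K) < b (r (Suc K))"
        using b(1) r(1) by (simp add: strict_mono_less)
      then have "b (r (Suc K)) - b (r K) \<in> B"
        using D(2) b(2) by blast
      moreover have "b (r (Suc K)) - b (r K) \<in> return_set T x U"
        using r(2)[of K "Suc K"] e(2) by (auto simp: return_set_def dist_norm norm_minus_commute)
      ultimately show ?thesis
        by blast
    qed
    then show "return_set T x U \<in> dual_family Delta_sets"
      using meets_Delta_sets_infinite[OF meets] unfolding dual_family_def by blast
  qed
qed

section \<open>Fourier sums along an orbit\<close>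

lemma root_of_unity_powers:
  fixes N :: nat
  assumes "N \<ge> 1"
  obtains w :: complex where "cmod w = 1" "w ^ N = 1"
    "\<And>n m. n < N \<Longrightarrow> m < N \<Longrightarrow> w ^ n = w ^ m \<longleftrightarrow> n = m"
proof
  define w where "w = exp (2 * of_real pi * \<i> * of_nat 1 / of_nat N)"
  have pow: "w ^ n = exp (2 * of_real pi * \<i> * of_nat n / of_nat N)" for n
    unfolding w_def by (simp flip: exp_of_nat_mult add: mult_ac)
  show "cmod w = 1"
    unfolding w_def by (simp add: norm_exp_eq_Re)
  show "w ^ N = 1"
    using complex_root_unity[of N 1] assms by (simp add: w_def)
  show "w ^ n = w ^ m \<longleftrightarrow> n = m" if "n < N" "m < N" for n m
    unfolding pow using complex_root_unity_eq[of N n m] assms that by (simp add: cong_def)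
qed

lemma sum_roots_of_unity:
  fixes w :: complex
  assumes w: "cmod w = 1" "w ^ N = 1" "\<And>n m. n < N \<Longrightarrow> m < N \<Longrightarrow> w ^ n = w ^ m \<longleftrightarrow> n = m"
    and nm: "n < N" "m < N"
  shows "(\<Sum>k<N. cnj (w ^ k) ^ n * (w ^ k) ^ m) = (if n = m then of_nat N else 0)"
proof -
  define z where "z = cnj w ^ n * w ^ m"
  have inv: "cnj w * w = 1"
    using w(1) complex_norm_square[of w] by (simp add: mult.commute)
  have z: "z * w ^ n = w ^ m"
    unfolding z_def by (metis (no_types, lifting) inv mult.assoc mult.commute mult_1 power_mult_distrib power_one)
  have "(\<Sum>k<N. cnj (w ^ k) ^ n * (w ^ k) ^ m) = (\<Sum>k<N. z ^ k)"
    unfolding z_def by (intro sum.cong) (auto simp: power_mult_distrib mult.commute simp flip: power_mult)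
  also have "\<dots> = (if n = m then of_nat N else 0)"
  proof (cases "n = m")
    case True
    then have "z = 1"
      unfolding z_def by (simp flip: power_mult_distrib add: inv)
    then show ?thesis
      using True by simp
  next
    case False
    then have "z \<noteq> 1"
      using z w(3)[OF nm] by auto
    moreover have "z ^ N = cnj (w ^ N) ^ n * (w ^ N) ^ m"
      unfolding z_def by (simp add: power_mult_distrib mult.commute flip: power_mult)
    ultimately show ?thesis
      using False w(2) by (simp add: sum_gp_strict)
  qed
  finally show ?thesis .
qed

text \<open>Orthogonality of characters in the form that serves both Parseval identities below: for the
  vectors and for their components along \<open>v\<close> only the kernel \<open>g\<close> differs.\<close>
lemma sum_roots_of_unity_diagonal:
  fixes w :: complex
  assumes w: "cmod w = 1" "w ^ N = 1" "\<And>n m. n < N \<Longrightarrow> m < N \<Longrightarrow> w ^ n = w ^ m \<longleftrightarrow> n = m"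
  shows "(\<Sum>k<N. \<Sum>n<N. \<Sum>m<N. cnj (w ^ k) ^ n * (w ^ k) ^ m * g n m) = of_nat N * (\<Sum>n<N. g n n)"
proof -
  have "(\<Sum>k<N. \<Sum>n<N. \<Sum>m<N. cnj (w ^ k) ^ n * (w ^ k) ^ m * g n m)
      = (\<Sum>n<N. \<Sum>m<N. \<Sum>k<N. cnj (w ^ k) ^ n * (w ^ k) ^ m * g n m)"
    by (subst sum.swap) (rule sum.cong[OF refl], rule sum.swap)
  also have "\<dots> = (\<Sum>n<N. \<Sum>m<N. (if n = m then of_nat N else 0) * g n m)"
    by (intro sum.cong refl) (simp only: sum_distrib_right[symmetric] sum_roots_of_unity[OF w] lessThan_iff)
  also have "\<dots> = (\<Sum>n<N. of_nat N * g n n)"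
    by (intro sum.cong refl) (simp add: if_distrib[of "\<lambda>x. x * _"] sum.delta cong: if_cong)
  finally show ?thesis
    by (simp add: sum_distrib_left)
qed

text \<open>On the unit circle \<open>cnj l\<close> is the inverse of \<open>l\<close>.\<close>
definition fourier_sum :: "complex \<Rightarrow> nat \<Rightarrow> (nat \<Rightarrow> 'a :: complex_inner) \<Rightarrow> 'a" where
  "fourier_sum l N x = (\<Sum>n<N. (cnj l ^ n) *\<^sub>C x n)"

lemma fourier_sum_parseval:
  fixes w :: complex
  assumes w: "cmod w = 1" "w ^ N = 1" "\<And>n m. n < N \<Longrightarrow> m < N \<Longrightarrow> w ^ n = w ^ m \<longleftrightarrow> n = m"
  shows "(\<Sum>k<N. (norm (fourier_sum (w ^ k) N x))\<^sup>2) = real N * (\<Sum>n<N. (norm (x n))\<^sup>2)"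
    and "(\<Sum>k<N. (cmod (cinner (fourier_sum (w ^ k) N x) v))\<^sup>2) = real N * (\<Sum>n<N. (cmod (cinner (x n) v))\<^sup>2)"
proof -
  have "of_real (\<Sum>k<N. (norm (fourier_sum (w ^ k) N x))\<^sup>2)
      = (\<Sum>k<N. cinner (fourier_sum (w ^ k) N x) (fourier_sum (w ^ k) N x))"
    by (simp add: cinner_self)
  also have "\<dots> = (\<Sum>k<N. \<Sum>n<N. \<Sum>m<N. cnj (w ^ k) ^ n * (w ^ k) ^ m * cinner (x n) (x m))"
    unfolding fourier_sum_def
    by (intro sum.cong refl, subst cinner_sum_left)
       (intro sum.cong refl, simp add: cinner_sum_right cinner_scaleC_left cinner_scaleC_right sum_distrib_left mult_ac)
  also have "\<dots> = of_nat N * (\<Sum>n<N. cinner (x n) (x n))"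
    by (rule sum_roots_of_unity_diagonal[OF w])
  also have "\<dots> = of_real (real N * (\<Sum>n<N. (norm (x n))\<^sup>2))"
    by (simp add: cinner_self)
  finally show "(\<Sum>k<N. (norm (fourier_sum (w ^ k) N x))\<^sup>2) = real N * (\<Sum>n<N. (norm (x n))\<^sup>2)"
    by (simp only: of_real_eq_iff)
  have "of_real (\<Sum>k<N. (cmod (cinner (fourier_sum (w ^ k) N x) v))\<^sup>2)
      = (\<Sum>k<N. cinner (fourier_sum (w ^ k) N x) v * cnj (cinner (fourier_sum (w ^ k) N x) v))"
    by (simp only: of_real_sum complex_norm_square)
  also have "\<dots> = (\<Sum>k<N. \<Sum>n<N. \<Sum>m<N. cnj (w ^ k) ^ n * (w ^ k) ^ m * (cinner (x n) v * cnj (cinner (x m) v)))"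
    unfolding fourier_sum_def
    by (intro sum.cong refl) (simp add: cinner_sum_left cinner_scaleC_left sum_product mult_ac)
  also have "\<dots> = of_nat N * (\<Sum>n<N. cinner (x n) v * cnj (cinner (x n) v))"
    by (rule sum_roots_of_unity_diagonal[OF w])
  also have "\<dots> = of_real (real N * (\<Sum>n<N. (cmod (cinner (x n) v))\<^sup>2))"
    by (simp only: of_real_sum of_real_mult of_real_of_nat_eq complex_norm_square)
  finally show "(\<Sum>k<N. (cmod (cinner (fourier_sum (w ^ k) N x) v))\<^sup>2) = real N * (\<Sum>n<N. (cmod (cinner (x n) v))\<^sup>2)"
    by (simp only: of_real_eq_iff)
qed

text \<open>The sum telescopes, and \<open>l ^ N = 1\<close> turns the two boundary terms into a single difference.\<close>
lemma fourier_sum_orbit_near_eigenvector: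
  fixes T :: "'a :: complex_inner \<Rightarrow> 'a"
  assumes T: "bounded_clinear T" and l: "cmod l = 1" "l ^ N = 1"
  shows "T (fourier_sum l N (\<lambda>n. (T ^^ n) x)) - l *\<^sub>C fourier_sum l N (\<lambda>n. (T ^^ n) x)
    = l *\<^sub>C ((T ^^ N) x - x)"
proof -
  interpret T: bounded_linear T
    using T by (simp add: bounded_clinear_def)
  have Tc: "T (c *\<^sub>C x) = c *\<^sub>C T x" for c x
    using T by (simp add: bounded_clinear_def)
  have inv: "l * cnj l = 1"
    using l(1) complex_norm_square[of l] by simp
  define f where "f n = (l * cnj l ^ n) *\<^sub>C (T ^^ n) x" for n
  have "T (fourier_sum l N (\<lambda>n. (T ^^ n) x)) = (\<Sum>n<N. f (Suc n))"
    unfolding fourier_sum_def f_def T.sum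
    by (intro sum.cong refl) (simp add: Tc inv flip: mult.assoc)
  moreover have "l *\<^sub>C fourier_sum l N (\<lambda>n. (T ^^ n) x) = (\<Sum>n<N. f n)"
    unfolding fourier_sum_def f_def
    by (simp add: bounded_linear.linear[OF bounded_linear_scaleC] linear_sum scaleC_scaleC)
  ultimately have "T (fourier_sum l N (\<lambda>n. (T ^^ n) x)) - l *\<^sub>C fourier_sum l N (\<lambda>n. (T ^^ n) x)
      = f N - f 0"
    by (simp add: sum_lessThan_telescope flip: sum_subtractf)
  also have "\<dots> = l *\<^sub>C ((T ^^ N) x - x)"
    using l(2) by (simp add: f_def linear_diff[OF bounded_linear.linear[OF bounded_linear_scaleC]] scaleC_one flip: complex_cnj_power)
  finally show ?thesis .
qed

section \<open>Eigenvectors from almost stationary random orbits\<close>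

text \<open>The vector \<open>W\<close> below is the covariance operator of the Fourier sum \<open>Y k\<close> applied to \<open>v\<close>. Its inner
  product with \<open>v\<close> is \<open>Q k\<close>, the second moment of the component of \<open>Y k\<close> along \<open>v\<close>, and its
  norm is at most \<open>norm v\<close> times the full second moment \<open>t k\<close>. Parseval bounds the sum of all \<open>Q k\<close> from
  below by \<open>N\<^sup>2 q\<close> and the sum of all \<open>t k\<close> from above by \<open>N\<^sup>2 \<tau>\<close>; hence some \<open>k\<close> has a good ratio. The vector
  sought is \<open>W\<close> divided by \<open>t k + N \<tau>\<close>.\<close>
lemma approximate_eigenvector:
  fixes T :: "'a :: separable_complex_hilbert_space \<Rightarrow> 'a" and X :: "'b \<Rightarrow> 'a"
  assumes T: "bounded_clinear T" and N: "N \<ge> 1" and \<tau>: "\<tau> > 0" and q: "q > 0"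
    and X: "X \<in> borel_measurable M"
    and int: "\<And>n. n \<le> N \<Longrightarrow> integrable M (\<lambda>\<omega>. (norm ((T ^^ n) (X \<omega>)))\<^sup>2)"
    and upper: "\<And>n. n \<le> N \<Longrightarrow> (\<integral>\<omega>. (norm ((T ^^ n) (X \<omega>)))\<^sup>2 \<partial>M) \<le> \<tau>"
    and lower: "\<And>n. n < N \<Longrightarrow> q \<le> (\<integral>\<omega>. (inner ((T ^^ n) (X \<omega>)) v)\<^sup>2 \<partial>M)"
  obtains l u where "cmod l = 1" "norm u \<le> norm v" "q / (2 * \<tau>) \<le> inner u v"
    "norm (T u - l *\<^sub>C u) \<le> 2 * norm v / sqrt (real N)"
proof -
  interpret T: bounded_linear T
    using T by (simp add: bounded_clinear_def)
  have Tc: "T (c *\<^sub>C x) = c *\<^sub>C T x" for c x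
    using T by (simp add: bounded_clinear_def)
  interpret S: bounded_linear "\<lambda>x :: 'a. c *\<^sub>C x" for c
    by (rule bounded_linear_scaleC)
  have T_meas: "(\<lambda>\<omega>. T (f \<omega>)) \<in> borel_measurable M" if "f \<in> borel_measurable M" for f
    by (rule borel_measurable_continuous_on[OF T.continuous_on[OF continuous_on_id] that])
  have S_meas: "(\<lambda>\<omega>. c *\<^sub>C (f \<omega> :: 'a)) \<in> borel_measurable M" if "f \<in> borel_measurable M" for f c
    by (rule borel_measurable_continuous_on[OF S.continuous_on[OF continuous_on_id] that])
  have orbit_meas[measurable]: "(\<lambda>\<omega>. (T ^^ n) (X \<omega>)) \<in> borel_measurable M" for n
  proof (induction n)
    case (Suc n)
    show ?case
      using T_meas[OF Suc] by simp
  qed (use X in simp)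
  obtain w :: complex where w: "cmod w = 1" "w ^ N = 1"
    "\<And>n m. n < N \<Longrightarrow> m < N \<Longrightarrow> w ^ n = w ^ m \<longleftrightarrow> n = m"
    by (rule root_of_unity_powers[OF N]) blast
  define Y where "Y k \<omega> = fourier_sum (w ^ k) N (\<lambda>n. (T ^^ n) (X \<omega>))" for k \<omega>
  have Y_meas[measurable]: "Y k \<in> borel_measurable M" for k
    unfolding Y_def fourier_sum_def by (intro borel_measurable_sum S_meas orbit_meas)
  have sq_sum: "(\<Sum>k<N. (norm (Y k \<omega>))\<^sup>2) = real N * (\<Sum>n<N. (norm ((T ^^ n) (X \<omega>)))\<^sup>2)" for \<omega>
    unfolding Y_def by (rule fourier_sum_parseval(1)[OF w])
  have int_sum: "integrable M (\<lambda>\<omega>. real N * (\<Sum>n<N. (norm ((T ^^ n) (X \<omega>)))\<^sup>2))"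
    using int by (intro integrable_mult_right integrable_sum) auto
  have Y_int: "integrable M (\<lambda>\<omega>. (norm (Y k \<omega>))\<^sup>2)" if "k < N" for k
  proof (rule Bochner_Integration.integrable_bound[OF int_sum])
    show "AE \<omega> in M. norm ((norm (Y k \<omega>))\<^sup>2) \<le> norm (real N * (\<Sum>n<N. (norm ((T ^^ n) (X \<omega>)))\<^sup>2))"
    proof (intro AE_I2)
      fix \<omega>
      have "(norm (Y k \<omega>))\<^sup>2 \<le> (\<Sum>k<N. (norm (Y k \<omega>))\<^sup>2)"
        using that by (intro member_le_sum) auto
      then show "norm ((norm (Y k \<omega>))\<^sup>2) \<le> norm (real N * (\<Sum>n<N. (norm ((T ^^ n) (X \<omega>)))\<^sup>2))"
        unfolding sq_sum by simp
    qed
  qed measurable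
  have cinner_sq: "(cmod (cinner y v))\<^sup>2 = (inner y v)\<^sup>2 + (inner y (\<i> *\<^sub>C v))\<^sup>2" for y :: 'a
    by (simp add: cinner_eq_Complex cmod_def)
  have C_int: "integrable M (\<lambda>\<omega>. (cmod (cinner (f \<omega>) v))\<^sup>2)"
    if "integrable M (\<lambda>\<omega>. (norm (f \<omega>))\<^sup>2)" and [measurable]: "f \<in> borel_measurable M" for f
  proof (rule Bochner_Integration.integrable_bound[OF integrable_mult_right[OF that(1), of "(norm v)\<^sup>2"]])
    show "(\<lambda>\<omega>. (cmod (cinner (f \<omega>) v))\<^sup>2) \<in> borel_measurable M"
      unfolding cinner_sq by measurable
  qed (use cmod_cinner_sq_le in auto)
  define t where "t k = (\<integral>\<omega>. (norm (Y k \<omega>))\<^sup>2 \<partial>M)" for k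
  define Q where "Q k = (\<integral>\<omega>. (cmod (cinner (Y k \<omega>) v))\<^sup>2 \<partial>M)" for k
  have t_nonneg: "t k \<ge> 0" for k
    by (simp add: t_def)
  have "(\<Sum>k<N. t k) = real N * (\<Sum>n<N. \<integral>\<omega>. (norm ((T ^^ n) (X \<omega>)))\<^sup>2 \<partial>M)"
    unfolding t_def using Y_int int
    by (subst Bochner_Integration.integral_sum[symmetric])
       (auto simp: sq_sum Bochner_Integration.integral_sum)
  also have "\<dots> \<le> real N * (\<Sum>n<N. \<tau>)"
    by (intro mult_left_mono sum_mono upper) auto
  finally have t_sum: "(\<Sum>k<N. t k) \<le> (real N)\<^sup>2 * \<tau>"
    by (simp add: power2_eq_square)
  have "(real N)\<^sup>2 * q = real N * (\<Sum>n<N. q)"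
    by (simp add: power2_eq_square)
  also have "\<dots> \<le> real N * (\<Sum>n<N. \<integral>\<omega>. (cmod (cinner ((T ^^ n) (X \<omega>)) v))\<^sup>2 \<partial>M)"
  proof (intro mult_left_mono sum_mono)
    fix n assume "n \<in> {..<N}"
    then have n: "n < N"
      by simp
    have ci: "integrable M (\<lambda>\<omega>. (cmod (cinner ((T ^^ n) (X \<omega>)) v))\<^sup>2)"
      using n int by (intro C_int orbit_meas) auto
    have "q \<le> (\<integral>\<omega>. (inner ((T ^^ n) (X \<omega>)) v)\<^sup>2 \<partial>M)"
      by (rule lower[OF n])
    also have "\<dots> \<le> (\<integral>\<omega>. (cmod (cinner ((T ^^ n) (X \<omega>)) v))\<^sup>2 \<partial>M)"
    proof (rule integral_mono[OF _ ci])
      show "integrable M (\<lambda>\<omega>. (inner ((T ^^ n) (X \<omega>)) v)\<^sup>2)"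
        by (rule Bochner_Integration.integrable_bound[OF ci]) (auto simp: cinner_sq)
    qed (simp add: cinner_sq)
    finally show "q \<le> (\<integral>\<omega>. (cmod (cinner ((T ^^ n) (X \<omega>)) v))\<^sup>2 \<partial>M)" .
  qed simp
  also have "\<dots> = (\<integral>\<omega>. real N * (\<Sum>n<N. (cmod (cinner ((T ^^ n) (X \<omega>)) v))\<^sup>2) \<partial>M)"
    using int by (subst integral_mult_right_zero, subst Bochner_Integration.integral_sum) (auto intro!: C_int)
  also have "\<dots> = (\<integral>\<omega>. (\<Sum>k<N. (cmod (cinner (Y k \<omega>) v))\<^sup>2) \<partial>M)"
    by (simp only: Y_def fourier_sum_parseval(2)[OF w])
  also have "\<dots> = (\<Sum>k<N. Q k)"
    unfolding Q_def using Y_int by (intro Bochner_Integration.integral_sum) (auto intro!: C_int)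
  finally have Q_sum: "(real N)\<^sup>2 * q \<le> (\<Sum>k<N. Q k)" .
  define c where "c = q / (2 * \<tau>)"
  \<comment> \<open>The summand \<open>N \<tau>\<close> excludes indices for which \<open>t k\<close> is so small that the defect
      \<open>T Y - l Y\<close>, of fixed size, would not be negligible. It costs only a factor \<open>2\<close> in \<open>c\<close>.\<close>
  define s where "s k = t k + real N * \<tau>" for k
  have s_pos: "s k > 0" for k
    unfolding s_def using t_nonneg[of k] N \<tau> by (intro add_nonneg_pos) auto
  have "\<exists>k<N. c * s k \<le> Q k"
  proof (rule ccontr)
    assume "\<not> ?thesis"
    then have "(\<Sum>k<N. Q k) < (\<Sum>k<N. c * s k)"
      using N by (intro sum_strict_mono) (auto simp: not_le lessThan_empty_iff)
    also have "\<dots> = c * ((\<Sum>k<N. t k) + (real N)\<^sup>2 * \<tau>)"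
      by (simp add: s_def sum.distrib sum_distrib_left power2_eq_square algebra_simps)
    also have "\<dots> \<le> c * (2 * (real N)\<^sup>2 * \<tau>)"
      using t_sum q \<tau> by (intro mult_left_mono) (auto simp: c_def mult.commute)
    also have "\<dots> = (real N)\<^sup>2 * q"
      using \<tau> by (simp add: c_def)
    finally show False
      using Q_sum by simp
  qed
  then obtain k where k: "k < N" "c * s k \<le> Q k"
    by blast
  define l where "l = w ^ k"
  have "l ^ N = (w ^ N) ^ k"
    by (simp add: l_def mult.commute flip: power_mult)
  then have l: "cmod l = 1" "l ^ N = 1"
    using w(1,2) by (simp_all add: l_def norm_power)
  \<comment> \<open>The rank-one map \<open>y \<mapsto> \<langle>v, y\<rangle> y\<close>, written with real inner products to make measurability evident.\<close>
  define P where "P y = inner y v *\<^sub>R y - inner y (\<i> *\<^sub>C v) *\<^sub>R (\<i> *\<^sub>C y)" for y :: 'a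
  have P_eq: "P y = cnj (cinner y v) *\<^sub>C y" for y
  proof -
    have "cnj (cinner y v) = of_real (inner y v) - of_real (inner y (\<i> *\<^sub>C v)) * \<i>"
      by (simp add: cinner_eq_Complex complex_eq_iff)
    then show ?thesis
      unfolding P_def by (simp only: complex_vector.scale_left_diff_distrib scaleR_scaleC scaleC_scaleC)
  qed
  have P_meas[measurable]: "(\<lambda>\<omega>. P (Y k \<omega>)) \<in> borel_measurable M"
    unfolding P_def using S_meas[OF Y_meas] by measurable
  have norm_P: "norm (P y) \<le> norm v * (norm y)\<^sup>2" for y
    unfolding P_eq norm_scaleC using mult_right_mono[OF cmod_cinner_le[of y v] norm_ge_zero[of y]]
    by (simp add: power2_eq_square mult_ac)
  have inner_P: "inner (P y) v = (cmod (cinner y v))\<^sup>2" for y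
    by (simp add: P_eq inner_eq_Re_cinner cinner_scaleC_left cmod_power2 flip: power2_eq_square)
  have P_int: "integrable M (\<lambda>\<omega>. P (Y k \<omega>))"
    by (rule Bochner_Integration.integrable_bound[OF integrable_mult_right[OF Y_int[OF k(1)], of "norm v"]])
       (auto simp: norm_P)
  define W where "W = (\<integral>\<omega>. P (Y k \<omega>) \<partial>M)"
  have norm_W: "norm W \<le> norm v * t k"
  proof -
    have "norm W \<le> (\<integral>\<omega>. norm (P (Y k \<omega>)) \<partial>M)"
      unfolding W_def by (rule integral_norm_bound)
    also have "\<dots> \<le> (\<integral>\<omega>. norm v * (norm (Y k \<omega>))\<^sup>2 \<partial>M)"
      using P_int Y_int[OF k(1)] by (intro integral_mono integrable_norm integrable_mult_right norm_P) auto
    also have "\<dots> = norm v * t k"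
      unfolding t_def by simp
    finally show ?thesis .
  qed
  have inner_W: "inner W v = Q k"
    unfolding W_def Q_def using P_int by (subst integral_inner_left[symmetric]) (auto simp: inner_P)
  define Z where "Z \<omega> = (T ^^ N) (X \<omega>) - X \<omega>" for \<omega>
  have Z_sq: "(norm (Z \<omega>))\<^sup>2 \<le> 2 * (norm ((T ^^ N) (X \<omega>)))\<^sup>2 + 2 * (norm ((T ^^ 0) (X \<omega>)))\<^sup>2" for \<omega>
    using sq_norm_add_le[of "(T ^^ N) (X \<omega>)" "- X \<omega>"] by (simp add: Z_def)
  have Z_meas[measurable]: "Z \<in> borel_measurable M"
    unfolding Z_def using X orbit_meas by measurable
  have Z_bd: "integrable M (\<lambda>\<omega>. 2 * (norm ((T ^^ N) (X \<omega>)))\<^sup>2 + 2 * (norm ((T ^^ 0) (X \<omega>)))\<^sup>2)"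
    using int[of N] int[of 0] by (intro Bochner_Integration.integrable_add integrable_mult_right) auto
  have Z_int: "integrable M (\<lambda>\<omega>. (norm (Z \<omega>))\<^sup>2)"
    by (rule Bochner_Integration.integrable_bound[OF Z_bd]) (use Z_sq in auto)
  have Z_le: "(\<integral>\<omega>. (norm (Z \<omega>))\<^sup>2 \<partial>M) \<le> 4 * \<tau>"
  proof -
    have "(\<integral>\<omega>. (norm (Z \<omega>))\<^sup>2 \<partial>M)
        \<le> (\<integral>\<omega>. 2 * (norm ((T ^^ N) (X \<omega>)))\<^sup>2 + 2 * (norm ((T ^^ 0) (X \<omega>)))\<^sup>2 \<partial>M)"
      by (intro integral_mono Z_int Z_bd Z_sq)
    also have "\<dots> = 2 * (\<integral>\<omega>. (norm ((T ^^ N) (X \<omega>)))\<^sup>2 \<partial>M) + 2 * (\<integral>\<omega>. (norm ((T ^^ 0) (X \<omega>)))\<^sup>2 \<partial>M)"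
      using int[of N] int[of 0] by (subst Bochner_Integration.integral_add) auto
    finally show ?thesis
      using upper[of N] upper[of 0] by linarith
  qed
  define r where "r = sqrt (real N)"
  have r: "r > 0" "r * r = real N"
    using N by (auto simp: r_def)
  have defect: "norm (T (P (Y k \<omega>)) - l *\<^sub>C P (Y k \<omega>))
      \<le> norm v / 2 * ((norm (Y k \<omega>))\<^sup>2 / r + r * (norm (Z \<omega>))\<^sup>2)" for \<omega>
  proof -
    have "T (P (Y k \<omega>)) - l *\<^sub>C P (Y k \<omega>) = cnj (cinner (Y k \<omega>) v) *\<^sub>C (T (Y k \<omega>) - l *\<^sub>C Y k \<omega>)"
      by (simp add: P_eq Tc S.diff scaleC_scaleC mult.commute)
    also have "\<dots> = cnj (cinner (Y k \<omega>) v) *\<^sub>C (l *\<^sub>C Z \<omega>)"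
      using fourier_sum_orbit_near_eigenvector[OF T l, of "X \<omega>"] by (simp add: Y_def l_def Z_def)
    also have "norm \<dots> \<le> norm v * (norm (Y k \<omega>) * norm (Z \<omega>))"
      using mult_right_mono[OF cmod_cinner_le[of "Y k \<omega>" v] norm_ge_zero[of "Z \<omega>"]] l(1)
      by (simp add: norm_scaleC norm_mult mult_ac)
    \<comment> \<open>The weight \<open>r = sqrt N\<close> balances the two moments, which are of order \<open>N \<tau>\<close> and \<open>\<tau>\<close>.\<close>
    also have "norm (Y k \<omega>) * norm (Z \<omega>) \<le> 1 / 2 * ((norm (Y k \<omega>))\<^sup>2 / r + r * (norm (Z \<omega>))\<^sup>2)"
    proof -
      have "0 \<le> (norm (Y k \<omega>) - r * norm (Z \<omega>))\<^sup>2"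
        by simp
      then have "2 * (norm (Y k \<omega>) * norm (Z \<omega>)) * r \<le> (norm (Y k \<omega>))\<^sup>2 + r * (norm (Z \<omega>))\<^sup>2 * r"
        by (simp add: power2_diff power_mult_distrib) (simp add: power2_eq_square mult_ac)
      then show ?thesis
        using r(1) by (simp add: field_simps)
    qed
    finally show ?thesis
      by (simp add: mult_left_mono)
  qed
  have TW: "T W - l *\<^sub>C W = (\<integral>\<omega>. T (P (Y k \<omega>)) - l *\<^sub>C P (Y k \<omega>) \<partial>M)"
    unfolding W_def
    using integral_bounded_linear[OF T.bounded_linear_axioms P_int]
      integral_bounded_linear[OF bounded_linear_scaleC P_int, of l]
      integrable_bounded_linear[OF T.bounded_linear_axioms P_int]
      integrable_bounded_linear[OF bounded_linear_scaleC P_int, of l]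
    by (simp add: Bochner_Integration.integral_diff)
  have defect_int: "integrable M (\<lambda>\<omega>. norm v / 2 * ((norm (Y k \<omega>))\<^sup>2 / r + r * (norm (Z \<omega>))\<^sup>2))"
    using Y_int[OF k(1)] Z_int by (intro integrable_mult_right Bochner_Integration.integrable_add) auto
  have norm_TW: "norm (T W - l *\<^sub>C W) \<le> norm v / 2 * (t k / r + r * (4 * \<tau>))"
  proof -
    have "norm (T W - l *\<^sub>C W) \<le> (\<integral>\<omega>. norm (T (P (Y k \<omega>)) - l *\<^sub>C P (Y k \<omega>)) \<partial>M)"
      unfolding TW by (rule integral_norm_bound)
    also have "\<dots> \<le> (\<integral>\<omega>. norm v / 2 * ((norm (Y k \<omega>))\<^sup>2 / r + r * (norm (Z \<omega>))\<^sup>2) \<partial>M)"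
      using integrable_bounded_linear[OF T.bounded_linear_axioms P_int]
        integrable_bounded_linear[OF bounded_linear_scaleC P_int, of l]
      by (intro integral_mono defect defect_int integrable_norm Bochner_Integration.integrable_diff)
    also have "\<dots> = norm v / 2 * (t k / r + r * (\<integral>\<omega>. (norm (Z \<omega>))\<^sup>2 \<partial>M))"
      using Y_int[OF k(1)] Z_int unfolding t_def by (simp add: Bochner_Integration.integral_add)
    also have "\<dots> \<le> norm v / 2 * (t k / r + r * (4 * \<tau>))"
      using Z_le r(1) by (intro mult_left_mono add_left_mono) auto
    finally show ?thesis .
  qed
  define u where "u = (1 / s k) *\<^sub>R W"
  show ?thesis
  proof (rule that[of l u])
    show "cmod l = 1"
      by (rule l)
    have "norm v * t k \<le> norm v * s k"
      using N \<tau> by (intro mult_left_mono) (auto simp: s_def)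
    then have "norm W \<le> norm v * s k"
      using norm_W by linarith
    then show "norm u \<le> norm v"
      using s_pos[of k] by (simp add: u_def field_simps)
    show "q / (2 * \<tau>) \<le> inner u v"
      using k(2) s_pos[of k] by (simp add: u_def inner_W c_def field_simps)
    have "T u - l *\<^sub>C u = (1 / s k) *\<^sub>R (T W - l *\<^sub>C W)"
      by (simp add: u_def T.scaleR scaleC_scaleR scaleR_diff_right)
    then have "norm (T u - l *\<^sub>C u) = norm (T W - l *\<^sub>C W) / s k"
      using s_pos[of k] by simp
    also have "\<dots> \<le> (norm v / 2 * (t k / r + r * (4 * \<tau>))) / s k"
      using norm_TW s_pos[of k] by (intro divide_right_mono) auto
    also have "t k / r + r * (4 * \<tau>) \<le> 4 * s k / r"
    proof -
      have "t k + r * r * (4 * \<tau>) \<le> 4 * s k"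
        using t_nonneg[of k] by (simp add: s_def r(2))
      then have "(t k + r * r * (4 * \<tau>)) / r \<le> 4 * s k / r"
        using r(1) by (intro divide_right_mono) auto
      then show ?thesis
        using r(1) by (simp add: add_divide_distrib)
    qed
    then have "(norm v / 2 * (t k / r + r * (4 * \<tau>))) / s k \<le> (norm v / 2 * (4 * s k / r)) / s k"
      using s_pos[of k] by (intro divide_right_mono mult_left_mono) auto
    also have "\<dots> = 2 * norm v / sqrt (real N)"
      using s_pos[of k] by (simp add: r_def)
    finally show "norm (T u - l *\<^sub>C u) \<le> 2 * norm v / sqrt (real N)" .
  qed
qed

text \<open>The eigenvalues subconverge on the circle to some \<open>l0\<close>. For each tolerance, the vectors of norm at
  most \<open>B\<close> with inner product at least \<open>c\<close> that are eigenvectors for \<open>l0\<close> up to this tolerance form a bounded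
  closed convex nonempty set, so some vector works for all tolerances.\<close>
lemma eigenvector_from_approximate_eigenvectors:
  fixes T :: "'a :: complex_hilbert_space \<Rightarrow> 'a"
  assumes T: "bounded_clinear T" and c: "c > 0"
    and approx: "\<And>N :: nat. N \<ge> 1 \<Longrightarrow>
      \<exists>l u. cmod l = 1 \<and> norm u \<le> B \<and> c \<le> inner u v \<and> norm (T u - l *\<^sub>C u) \<le> b / sqrt (real N)"
  shows "\<exists>u\<in>unimodular_eigenvectors T. inner u v > 0"
proof -
  interpret T: bounded_linear T
    using T by (simp add: bounded_clinear_def)
  have "\<exists>l u. cmod l = 1 \<and> norm u \<le> B \<and> c \<le> inner u v \<and> norm (T u - l *\<^sub>C u) \<le> b / sqrt (real (Suc n))" for n
    by (rule approx) simp
  then obtain l u where lu: "\<And>n. cmod (l n) = 1" "\<And>n. norm (u n) \<le> B" "\<And>n. c \<le> inner (u n) v"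
    "\<And>n. norm (T (u n) - l n *\<^sub>C u n) \<le> b / sqrt (real (Suc n))"
    by metis
  have "compact (sphere (0 :: complex) 1)"
    by simp
  then obtain l0 r where r: "l0 \<in> sphere 0 1" "strict_mono r" "(l \<circ> r) \<longlonglongrightarrow> l0"
    using lu(1) unfolding compact_def by (metis mem_sphere_0)
  define A where "A x = T x - l0 *\<^sub>C x" for x
  interpret A: bounded_linear A
    unfolding A_def by (intro bounded_linear_sub T.bounded_linear_axioms bounded_linear_scaleC)
  define D where "D n = cball 0 B \<inter> {x. inner v x \<ge> c} \<inter> A -` cball 0 (inverse (real (Suc n)))" for n
  have A_bound: "norm (A (u (r n))) \<le> b / sqrt (real (Suc (r n))) + cmod (l (r n) - l0) * B" for n
  proof -
    have "A (u (r n)) = (T (u (r n)) - l (r n) *\<^sub>C u (r n)) + (l (r n) - l0) *\<^sub>C u (r n)"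
      by (simp add: A_def complex_vector.scale_left_diff_distrib)
    also have "norm \<dots> \<le> b / sqrt (real (Suc (r n))) + cmod (l (r n) - l0) * norm (u (r n))"
      using lu(4)[of "r n"] norm_triangle_ineq norm_scaleC
      by (metis (no_types, opaque_lifting) add_mono order_refl order_trans)
    also have "\<dots> \<le> b / sqrt (real (Suc (r n))) + cmod (l (r n) - l0) * B"
      by (intro add_left_mono mult_left_mono lu) auto
    finally show ?thesis .
  qed
  have lim: "(\<lambda>n. b / sqrt (real (Suc (r n))) + cmod (l (r n) - l0) * B) \<longlonglongrightarrow> 0"
  proof -
    have "(\<lambda>n. b / sqrt (real (Suc n))) \<longlonglongrightarrow> 0"
      by real_asymp
    then have "(\<lambda>n. b / sqrt (real (Suc (r n)))) \<longlonglongrightarrow> 0"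
      using LIMSEQ_subseq_LIMSEQ[OF _ r(2)] by (simp add: o_def)
    moreover have "(\<lambda>n. cmod (l (r n) - l0) * B) \<longlonglongrightarrow> 0"
      using r(3) by (intro tendsto_mult_left_zero tendsto_norm_zero) (simp add: o_def LIM_zero_iff)
    ultimately show ?thesis
      using tendsto_add by fastforce
  qed
  have "(\<Inter>n. D n) \<noteq> {}"
  proof (rule nested_bounded_closed_convex_Inter_nonempty)
    fix n
    show "closed (D n)"
      unfolding D_def
      by (intro closed_Int closed_halfspace_ge closed_cball closed_vimage A.continuous_on continuous_on_id)
    show "convex (D n)"
      unfolding D_def
      by (intro convex_Int convex_halfspace_ge convex_cball convex_linear_vimage A.linear_axioms)
    have "\<forall>\<^sub>F m in sequentially. b / sqrt (real (Suc (r m))) + cmod (l (r m) - l0) * B < inverse (real (Suc n))"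
      using lim by (rule order_tendstoD) simp
    then obtain m where "b / sqrt (real (Suc (r m))) + cmod (l (r m) - l0) * B < inverse (real (Suc n))"
      by (auto dest: eventually_happens)
    then have "u (r m) \<in> D n"
      using A_bound[of m] lu(2,3)[of "r m"] by (simp add: D_def inner_commute)
    then show "D n \<noteq> {}"
      by blast
  next
    show "bounded (D 0)"
      unfolding D_def by (intro bounded_Int disjI1 bounded_cball)
    show "decseq D"
      unfolding decseq_def D_def
      by (intro allI impI Int_mono vimage_mono order_refl subset_cball le_imp_inverse_le) auto
  qed
  then obtain x where x: "\<And>n. x \<in> D n"
    by blast
  have "norm (A x) \<le> 0"
  proof (rule LIMSEQ_le_const[OF LIMSEQ_inverse_real_of_nat])
    show "\<exists>N. \<forall>n\<ge>N. norm (A x) \<le> inverse (real (Suc n))"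
      using x by (auto simp: D_def)
  qed
  moreover have "inner x v \<ge> c"
    using x[of 0] by (simp add: D_def inner_commute)
  ultimately have "x \<in> unimodular_eigenvectors T"
    using r(1) c unfolding unimodular_eigenvectors_def A_def
    by (auto intro!: exI[of _ l0] simp: algebra_simps)
  then show ?thesis
    using \<open>inner x v \<ge> c\<close> c by force
qed

text \<open>Bounds that are uniform in \<open>N\<close>, with a measure that may depend on \<open>N\<close>, are the common ground of
  the two applications: uniform measures on windows of a single orbit, whose length grows with \<open>N\<close>, and
  invariant measures.\<close>
theorem exists_eigenvector_not_orthogonal:
  fixes T :: "'a :: separable_complex_hilbert_space \<Rightarrow> 'a" and v :: 'a
  assumes T: "bounded_clinear T" and "\<tau> > 0" "q > 0"
    and ex: "\<And>N :: nat. N \<ge> 1 \<Longrightarrow> \<exists>(M :: 'b measure) X. X \<in> borel_measurable M \<and>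
      (\<forall>n\<le>N. integrable M (\<lambda>\<omega>. (norm ((T ^^ n) (X \<omega>)))\<^sup>2) \<and>
        (\<integral>\<omega>. (norm ((T ^^ n) (X \<omega>)))\<^sup>2 \<partial>M) \<le> \<tau>) \<and>
      (\<forall>n<N. q \<le> (\<integral>\<omega>. (inner ((T ^^ n) (X \<omega>)) v)\<^sup>2 \<partial>M))"
  shows "\<exists>u\<in>unimodular_eigenvectors T. inner u v > 0"
proof (rule eigenvector_from_approximate_eigenvectors[OF T])
  show "q / (2 * \<tau>) > 0"
    using assms by simp
  fix N :: nat assume N: "N \<ge> 1"
  obtain M :: "'b measure" and X where "X \<in> borel_measurable M"
    "\<And>n. n \<le> N \<Longrightarrow> integrable M (\<lambda>\<omega>. (norm ((T ^^ n) (X \<omega>)))\<^sup>2)"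
    "\<And>n. n \<le> N \<Longrightarrow> (\<integral>\<omega>. (norm ((T ^^ n) (X \<omega>)))\<^sup>2 \<partial>M) \<le> \<tau>"
    "\<And>n. n < N \<Longrightarrow> q \<le> (\<integral>\<omega>. (inner ((T ^^ n) (X \<omega>)) v)\<^sup>2 \<partial>M)"
    using ex[OF N] by blast
  from approximate_eigenvector[OF T N \<open>\<tau> > 0\<close> \<open>q > 0\<close> this]
  show "\<exists>l u. cmod l = 1 \<and> norm u \<le> norm v \<and> q / (2 * \<tau>) \<le> inner u v \<and>
      norm (T u - l *\<^sub>C u) \<le> 2 * norm v / sqrt (real N)"
    by metis
qed

section \<open>Recurrent points with bounded orbit\<close>

lemma card_shift_window_ge:
  fixes A :: "nat set"
  shows "real (card (A \<inter> {m..m + L})) - real n \<le> real (card {j \<in> {m..m + L}. j + n \<in> A})"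
proof -
  have "A \<inter> {m..m + L} \<subseteq> {m..<m + n} \<union> (\<lambda>j. j + n) ` {j \<in> {m..m + L}. j + n \<in> A}"
  proof
    fix i assume i: "i \<in> A \<inter> {m..m + L}"
    show "i \<in> {m..<m + n} \<union> (\<lambda>j. j + n) ` {j \<in> {m..m + L}. j + n \<in> A}"
    proof (cases "i < m + n")
      case False
      then have "i = (i - n) + n" "i - n \<in> {j \<in> {m..m + L}. j + n \<in> A}"
        using i by auto
      then show ?thesis
        by blast
    qed (use i in auto)
  qed
  then have "card (A \<inter> {m..m + L}) \<le> card ({m..<m + n} \<union> (\<lambda>j. j + n) ` {j \<in> {m..m + L}. j + n \<in> A})"
    by (intro card_mono) auto
  also have "\<dots> \<le> n + card {j \<in> {m..m + L}. j + n \<in> A}"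
    by (intro order_trans[OF card_Un_le] add_mono card_image_le) auto
  finally show ?thesis
    by linarith
qed

text \<open>The half-space \<open>U\<close> is a neighbourhood of \<open>x\<close>. In a window of length \<open>L + 1\<close> with more than
  \<open>d (L + 1)\<close> visits to \<open>U\<close>, shifting by \<open>n < N\<close> loses at most \<open>N\<close> visits, which is at most half of them if \<open>L\<close>
  is large.\<close>
theorem RRec_bo_subset_closure_cspan:
  fixes T :: "'a :: separable_complex_hilbert_space \<Rightarrow> 'a"
  assumes T: "bounded_clinear T"
  shows "RRec_bo T \<subseteq> closure (cspan (unimodular_eigenvectors T))"
proof (rule subsetI, rule ccontr)
  fix x assume x: "x \<in> RRec_bo T" and "x \<notin> closure (cspan (unimodular_eigenvectors T))"
  then obtain v where v: "\<And>y. y \<in> unimodular_eigenvectors T \<Longrightarrow> inner y v = 0" "inner x v > 0"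
    using separate_from_closure_cspan by blast
  obtain C where C: "C > 0" "\<And>n. norm ((T ^^ n) x) \<le> C"
    using x unfolding RRec_bo_def bounded_orbit_points_def by (auto simp: bounded_pos)
  define \<delta> where "\<delta> = inner x v / 2"
  have \<delta>: "\<delta> > 0"
    using v by (simp add: \<delta>_def)
  define U where "U = {z. inner v z > \<delta>}"
  define A where "A = return_set T x U"
  have "open U"
    unfolding U_def by (rule open_halfspace_gt)
  moreover have "x \<in> U"
    using v by (simp add: U_def \<delta>_def inner_commute)
  ultimately have "upper_Banach_density A > 0"
    using x unfolding RRec_bo_def RRec_def recurrent_points_def A_def by (auto simp: interior_open)
  then obtain d where d: "d > 0"
    "\<And>K. \<exists>L\<ge>K. \<exists>m. d * real (L + 1) < real (card (A \<inter> {m..m + L}))"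
    by (rule upper_Banach_density_posE) blast
  have "\<exists>u\<in>unimodular_eigenvectors T. inner u v > 0"
  proof (rule exists_eigenvector_not_orthogonal[OF T, where \<tau> = "C\<^sup>2" and q = "\<delta>\<^sup>2 * (d / 2)"])
    fix N :: nat assume "N \<ge> 1"
    obtain K where K: "2 * real N / d \<le> real K"
      using real_arch_simple by blast
    obtain L m where L: "L \<ge> K" "d * real (L + 1) < real (card (A \<inter> {m..m + L}))"
      using d(2) by blast
    have "2 * real N \<le> d * real K"
      using K d(1) by (simp add: field_simps)
    also have "\<dots> \<le> d * real (L + 1)"
      using L(1) d(1) by (intro mult_left_mono) auto
    finally have N: "2 * real N \<le> d * real (L + 1)" .
    define p where "p = pmf_of_set {m..m + L}"
    have E: "measure_pmf.expectation p f = (\<Sum>j\<in>{m..m + L}. f j) / real (L + 1)" for f :: "nat \<Rightarrow> real"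
      unfolding p_def by (subst integral_pmf_of_set) auto
    have int: "integrable (measure_pmf p) f" for f :: "nat \<Rightarrow> real"
      unfolding p_def by (rule integrable_measure_pmf_finite) simp
    have upper: "measure_pmf.expectation p (\<lambda>j. (norm ((T ^^ n) ((T ^^ j) x)))\<^sup>2) \<le> C\<^sup>2" for n
    proof -
      have "measure_pmf.expectation p (\<lambda>j. (norm ((T ^^ n) ((T ^^ j) x)))\<^sup>2) \<le> measure_pmf.expectation p (\<lambda>j. C\<^sup>2)"
      proof (intro integral_mono int power_mono)
        fix j
        show "norm ((T ^^ n) ((T ^^ j) x)) \<le> C"
          using C(2)[of "n + j"] by (simp add: funpow_add)
      qed simp
      then show ?thesis
        by simp
    qed
    have lower: "\<delta>\<^sup>2 * (d / 2) \<le> measure_pmf.expectation p (\<lambda>j. (inner ((T ^^ n) ((T ^^ j) x)) v)\<^sup>2)"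
      if "n < N" for n
    proof -
      define J where "J = {j \<in> {m..m + L}. j + n \<in> A}"
      have "d / 2 * real (L + 1) \<le> d * real (L + 1) - real n"
        using N that by simp
      also have "\<dots> \<le> real (card (A \<inter> {m..m + L})) - real n"
        using L(2) by simp
      also have "\<dots> \<le> real (card J)"
        unfolding J_def by (rule card_shift_window_ge)
      finally have "\<delta>\<^sup>2 * (d / 2) * real (L + 1) \<le> \<delta>\<^sup>2 * real (card J)"
        using mult_left_mono[of _ _ "\<delta>\<^sup>2"] by (simp add: mult.assoc)
      also have "\<dots> = (\<Sum>j\<in>J. \<delta>\<^sup>2)"
        by simp
      also have "\<dots> \<le> (\<Sum>j\<in>J. (inner ((T ^^ n) ((T ^^ j) x)) v)\<^sup>2)"
      proof (intro sum_mono power_mono)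
        fix j assume "j \<in> J"
        then have "(T ^^ (n + j)) x \<in> U"
          by (simp add: J_def A_def return_set_def add.commute)
        then show "\<delta> \<le> inner ((T ^^ n) ((T ^^ j) x)) v"
          by (simp add: U_def funpow_add inner_commute)
      qed (use \<delta> in simp)
      also have "\<dots> \<le> (\<Sum>j\<in>{m..m + L}. (inner ((T ^^ n) ((T ^^ j) x)) v)\<^sup>2)"
        unfolding J_def by (intro sum_mono2) auto
      finally show ?thesis
        unfolding E by (simp add: pos_le_divide_eq)
    qed
    show "\<exists>(M :: nat measure) X. X \<in> borel_measurable M \<and>
      (\<forall>n\<le>N. integrable M (\<lambda>j. (norm ((T ^^ n) (X j)))\<^sup>2) \<and>
        (\<integral>j. (norm ((T ^^ n) (X j)))\<^sup>2 \<partial>M) \<le> C\<^sup>2) \<and>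
      (\<forall>n<N. \<delta>\<^sup>2 * (d / 2) \<le> (\<integral>j. (inner ((T ^^ n) (X j)) v)\<^sup>2 \<partial>M))"
      using upper lower int by (intro exI[of _ "measure_pmf p"] exI[of _ "\<lambda>j. (T ^^ j) x"]) auto
  qed (use C d \<delta> in auto)
  then show False
    using v(1) by force
qed

section \<open>Eigenvectors from invariant measures\<close>

lemma bounded_clinear_borel_measurable_funpow:
  fixes T :: "'a :: complex_inner \<Rightarrow> 'a"
  assumes "bounded_clinear T"
  shows "T ^^ n \<in> borel_measurable borel"
proof -
  interpret T: bounded_linear T
    using assms by (simp add: bounded_clinear_def)
  have T: "T \<in> borel_measurable borel"
    by (intro borel_measurable_continuous_onI T.continuous_on continuous_on_id)
  show ?thesis
    by (induction n) (auto intro: measurable_compose[OF _ T] simp: id_def)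
qed

lemma invariant_prob_measure_distr_funpow:
  fixes T :: "'a :: complex_inner \<Rightarrow> 'a"
  assumes T: "bounded_clinear T" and \<mu>: "invariant_prob_measure T \<mu>"
  shows "distr \<mu> \<mu> (T ^^ n) = \<mu>"
proof (rule measure_eqI)
  have sets: "sets \<mu> = sets borel"
    using \<mu> by (simp add: invariant_prob_measure_def)
  have space: "space \<mu> = UNIV"
    using sets_eq_imp_space_eq[OF sets] by simp
  fix A assume "A \<in> sets (distr \<mu> \<mu> (T ^^ n))"
  then have A: "A \<in> sets borel"
    by (simp add: sets)
  have meas: "(T ^^ n) -` A \<in> sets borel" for n
    using measurable_sets[OF bounded_clinear_borel_measurable_funpow[OF T] A] by simp
  have "emeasure \<mu> ((T ^^ n) -` A) = emeasure \<mu> A"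
  proof (induction n)
    case (Suc n)
    have eq: "(T ^^ Suc n) -` A = T -` ((T ^^ n) -` A)"
      by (simp add: vimage_comp funpow_Suc_right del: funpow.simps)
    show ?case
      unfolding eq using \<mu> meas Suc by (simp add: invariant_prob_measure_def)
  qed simp
  moreover have "T ^^ n \<in> measurable \<mu> \<mu>"
    using bounded_clinear_borel_measurable_funpow[OF T] by (simp add: measurable_cong_sets[OF sets sets])
  ultimately show "emeasure (distr \<mu> \<mu> (T ^^ n)) A = emeasure \<mu> A"
    using A by (subst emeasure_distr) (auto simp: sets space)
qed simp

text \<open>By invariance the second moments of \<open>T ^^ n\<close> and of its component along \<open>v\<close> are the same for all
  \<open>n\<close>, and the latter is positive exactly when the component does not vanish almost everywhere.\<close>
theorem eigenvector_from_invariant_measure: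
  fixes T :: "'a :: separable_complex_hilbert_space \<Rightarrow> 'a"
  assumes T: "bounded_clinear T" and \<mu>: "invariant_prob_measure T \<mu>" and fin: "finite_second_moment \<mu>"
    and v: "\<not> (AE z in \<mu>. inner z v = 0)"
  shows "\<exists>u\<in>unimodular_eigenvectors T. inner u v > 0"
proof -
  have sets[measurable_cong]: "sets \<mu> = sets borel"
    using \<mu> by (simp add: invariant_prob_measure_def)
  have T_meas: "T ^^ n \<in> measurable \<mu> \<mu>" for n
    using bounded_clinear_borel_measurable_funpow[OF T] by (simp add: measurable_cong_sets[OF sets sets])
  have moment_int: "integrable \<mu> (\<lambda>z. (norm z)\<^sup>2)"
    using fin unfolding finite_second_moment_def by (intro integrableI_nonneg) auto
  have inner_int: "integrable \<mu> (\<lambda>z. (inner z v)\<^sup>2)"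
  proof (rule Bochner_Integration.integrable_bound[OF integrable_mult_right[OF moment_int, of "(norm v)\<^sup>2"]])
    have "(inner z v)\<^sup>2 \<le> (norm v)\<^sup>2 * (norm z)\<^sup>2" for z
      using power_mono[OF Cauchy_Schwarz_ineq2[of z v], of 2] by (simp add: power_mult_distrib mult.commute)
    then show "AE z in \<mu>. norm ((inner z v)\<^sup>2) \<le> norm ((norm v)\<^sup>2 * (norm z)\<^sup>2)"
      by simp
  qed measurable
  define \<tau> where "\<tau> = (\<integral>z. (norm z)\<^sup>2 \<partial>\<mu>) + 1"
  define q where "q = (\<integral>z. (inner z v)\<^sup>2 \<partial>\<mu>)"
  have "q \<noteq> 0"
    using v integral_nonneg_eq_0_iff_AE[OF inner_int] by (simp add: q_def)
  moreover have "q \<ge> 0" "\<tau> > 0"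
    by (simp_all add: q_def \<tau>_def add_nonneg_pos)
  ultimately have "q > 0" "\<tau> > 0"
    by auto
  have int_T: "integrable \<mu> (\<lambda>z. f ((T ^^ n) z))" "(\<integral>z. f ((T ^^ n) z) \<partial>\<mu>) = (\<integral>z. f z \<partial>\<mu>)"
    if "integrable \<mu> f" for f :: "'a \<Rightarrow> real" and n
    using integrable_distr[OF T_meas[of n], of f] integral_distr[OF T_meas[of n], of f] that
    by (simp_all add: invariant_prob_measure_distr_funpow[OF T \<mu>])
  show ?thesis
  proof (rule exists_eigenvector_not_orthogonal[OF T \<open>\<tau> > 0\<close> \<open>q > 0\<close>])
    fix N :: nat
    have "(\<lambda>z. z) \<in> borel_measurable \<mu>"
      by measurable
    then show "\<exists>(M :: 'a measure) X. X \<in> borel_measurable M \<and>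
      (\<forall>n\<le>N. integrable M (\<lambda>z. (norm ((T ^^ n) (X z)))\<^sup>2) \<and>
        (\<integral>z. (norm ((T ^^ n) (X z)))\<^sup>2 \<partial>M) \<le> \<tau>) \<and>
      (\<forall>n<N. q \<le> (\<integral>z. (inner ((T ^^ n) (X z)) v)\<^sup>2 \<partial>M))"
      using int_T[OF moment_int] int_T[OF inner_int]
      by (intro exI[of _ \<mu>] exI[of _ "\<lambda>z. z"]) (auto simp: \<tau>_def q_def)
  qed
qed

text \<open>Without eigenvectors almost every \<open>z\<close> is orthogonal to each single \<open>v\<close>, hence to a countable dense
  set of them.\<close>
lemma invariant_measure_eq_return_0_if_no_unimodular_eigenvectors:
  fixes T :: "'a :: separable_complex_hilbert_space \<Rightarrow> 'a"
  assumes T: "bounded_clinear T" and \<mu>: "invariant_prob_measure T \<mu>" and fin: "finite_second_moment \<mu>"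
    and E: "unimodular_eigenvectors T = {}"
  shows "\<mu> = return borel 0"
proof -
  have sets[measurable_cong]: "sets \<mu> = sets borel"
    using \<mu> by (simp add: invariant_prob_measure_def)
  interpret prob_space \<mu>
    using \<mu> by (simp add: invariant_prob_measure_def)
  obtain D :: "'a set" where D: "countable D" "\<And>U. open U \<Longrightarrow> U \<noteq> {} \<Longrightarrow> D \<inter> U \<noteq> {}"
    using separable by blast
  have "AE z in \<mu>. inner z v = 0" for v
    using eigenvector_from_invariant_measure[OF T \<mu> fin, of v] E by blast
  then have "AE z in \<mu>. \<forall>v\<in>D. inner z v = 0"
    by (intro AE_ball_countable'[OF _ D(1)])
  moreover have "z = 0" if z: "\<forall>v\<in>D. inner z v = 0" for z
  proof (rule ccontr)
    assume "z \<noteq> 0"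
    then have "z \<in> {v. inner z v > 0}"
      by simp
    then have "D \<inter> {v. inner z v > 0} \<noteq> {}"
      using D(2)[OF open_halfspace_gt] by blast
    then show False
      using z by auto
  qed
  ultimately have ae: "AE z in \<mu>. z = 0"
    by (auto elim: eventually_mono)
  show ?thesis
  proof (rule measure_eqI)
    fix A assume "A \<in> sets \<mu>"
    then have A: "A \<in> sets borel"
      by (simp add: sets)
    show "emeasure \<mu> A = emeasure (return borel 0) A"
    proof (cases "0 \<in> A")
      case True
      then have "AE z in \<mu>. z \<in> A"
        using ae by (auto elim: eventually_mono)
      then have "emeasure \<mu> A = 1"
        using A sets by (simp add: emeasure_eq_1_AE)
      then show ?thesis
        using True A by simp
    next
      case False
      then have "AE z in \<mu>. z \<notin> A"
        using ae by (auto elim: eventually_mono)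
      then have "emeasure \<mu> A = 0"
        using A sets sets_eq_imp_space_eq[OF sets] AE_iff_measurable[of A \<mu> "\<lambda>z. z \<notin> A"] by simp
      then show ?thesis
        using False A by simp
    qed
  qed (simp add: sets)
qed

section \<open>Uniform measure on the unit circle\<close>

lemma emeasure_lborel_translate:
  fixes S :: "real set"
  assumes "S \<in> sets borel"
  shows "emeasure lborel {t. t + a \<in> S} = emeasure lborel S"
proof -
  have "emeasure lborel S = emeasure (distr lborel borel ((+) a)) S"
    by (simp add: lborel_distr_plus)
  also have "\<dots> = emeasure lborel ((+) a -` S \<inter> space lborel)"
    using assms by (intro emeasure_distr) auto
  also have "(+) a -` S \<inter> space lborel = {t. t + a \<in> S}"
    by (auto simp: add.commute)
  finally show ?thesis ..
qed

text \<open>Translation by \<open>a\<close> moves the unit interval to \<open>{a..<1 + a}\<close>; the part beyond \<open>1\<close> is brought back by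
  the period.\<close>
lemma emeasure_periodic_unit_interval:
  fixes S :: "real set"
  assumes S: "S \<in> sets borel" and per: "\<And>t. t + 1 \<in> S \<longleftrightarrow> t \<in> S" and a: "0 \<le> a" "a < 1"
  shows "emeasure lborel ({0..<1} \<inter> {t. t + a \<in> S}) = emeasure lborel ({0..<1} \<inter> S)"
proof -
  have "{0..<1} \<inter> {t. t + a \<in> S} = {t. t + a \<in> {a..<1 + a} \<inter> S}"
    by auto
  then have "emeasure lborel ({0..<1} \<inter> {t. t + a \<in> S}) = emeasure lborel ({a..<1 + a} \<inter> S)"
    using S by (simp add: emeasure_lborel_translate del: Int_iff)
  also have "{a..<1 + a} \<inter> S = ({a..<1} \<inter> S) \<union> ({1..<1 + a} \<inter> S)"
    using a by auto
  also have "emeasure lborel \<dots> = emeasure lborel ({a..<1} \<inter> S) + emeasure lborel ({1..<1 + a} \<inter> S)"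
    using S a by (intro plus_emeasure[symmetric]) auto
  also have "emeasure lborel ({1..<1 + a} \<inter> S) = emeasure lborel {t. t + 1 \<in> {1..<1 + a} \<inter> S}"
    using S by (intro emeasure_lborel_translate[symmetric]) auto
  also have "{t. t + 1 \<in> {1..<1 + a} \<inter> S} = {0..<a} \<inter> S"
    using per by auto
  also have "emeasure lborel ({a..<1} \<inter> S) + emeasure lborel ({0..<a} \<inter> S)
      = emeasure lborel (({a..<1} \<inter> S) \<union> ({0..<a} \<inter> S))"
    using S by (intro plus_emeasure) auto
  also have "({a..<1} \<inter> S) \<union> ({0..<a} \<inter> S) = {0..<1} \<inter> S"
    using a by auto
  finally show ?thesis .
qed

definition circle_measure :: "complex measure" where
  "circle_measure = distr (uniform_measure lborel {0..<1}) borel (\<lambda>t. cis (2 * pi * t))"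

lemma cis_borel_measurable: "(\<lambda>t. cis (2 * pi * t)) \<in> borel_measurable borel"
  by (intro borel_measurable_continuous_onI continuous_intros)

lemma sets_circle_measure: "sets circle_measure = sets borel"
  by (simp add: circle_measure_def)

lemma prob_space_circle_measure: "prob_space circle_measure"
proof -
  interpret prob_space "uniform_measure lborel {0..<1 :: real}"
    by (rule prob_space_uniform_measure) auto
  show ?thesis
    unfolding circle_measure_def using cis_borel_measurable by (intro prob_space_distr) simp
qed

lemma emeasure_circle_measure:
  assumes "A \<in> sets borel"
  shows "emeasure circle_measure A = emeasure lborel ({0..<1} \<inter> {t. cis (2 * pi * t) \<in> A})"
proof -
  have "(\<lambda>t. cis (2 * pi * t)) -` A \<in> sets borel"
    using measurable_sets[OF cis_borel_measurable assms] by simp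
  then have "{t. cis (2 * pi * t) \<in> A} \<in> sets borel"
    by (simp add: vimage_def)
  then show ?thesis
    unfolding circle_measure_def using assms cis_borel_measurable
    by (subst emeasure_distr) (auto simp: emeasure_uniform_measure vimage_def divide_ennreal_def)
qed

text \<open>A rotation of the circle is a translation of the angle, and the preimage of \<open>A\<close> under
  \<open>t \<mapsto> cis (2 \<pi> t)\<close> has period \<open>1\<close>.\<close>
lemma circle_measure_rotation_invariant:
  assumes A: "A \<in> sets borel" and l: "cmod l = 1"
  shows "emeasure circle_measure {z. l * z \<in> A} = emeasure circle_measure A"
proof -
  define a where "a = Arg2pi l / (2 * pi)"
  have a: "0 \<le> a" "a < 1"
    using Arg2pi_ge_0[of l] Arg2pi_lt_2pi[of l] by (auto simp: a_def)
  have "l = cis (2 * pi * a)"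
    using Arg2pi_eq[of l] l by (simp add: a_def cis_conv_exp)
  then have "l * cis (2 * pi * t) = cis (2 * pi * (t + a))" for t
    by (simp add: cis_mult algebra_simps)
  then have eq: "{t. cis (2 * pi * t) \<in> {z. l * z \<in> A}} = {t. t + a \<in> {t. cis (2 * pi * t) \<in> A}}"
    by auto
  have per: "cis (2 * pi * (t + 1)) = cis (2 * pi * t)" for t
    by (simp add: distrib_left flip: cis_mult)
  have "(\<lambda>z. l * z) \<in> borel_measurable borel"
    by measurable
  from measurable_sets[OF this A] have lA: "{z. l * z \<in> A} \<in> sets borel"
    by (simp add: vimage_def)
  have S: "{t. cis (2 * pi * t) \<in> A} \<in> sets borel"
    using measurable_sets[OF cis_borel_measurable A] by (simp add: vimage_def)
  show ?thesis
    unfolding emeasure_circle_measure[OF lA] emeasure_circle_measure[OF A] eq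
    by (rule emeasure_periodic_unit_interval[OF S _ a]) (simp add: per)
qed

lemma circle_measure_neighbourhood_1:
  assumes "open W" "1 \<in> W"
  shows "emeasure circle_measure W > 0"
proof -
  have "open ((\<lambda>t. cis (2 * pi * t)) -` W)"
    by (intro open_vimage assms continuous_intros)
  moreover have "0 \<in> (\<lambda>t. cis (2 * pi * t)) -` W"
    using assms by simp
  ultimately obtain e where e: "e > 0" "ball 0 e \<subseteq> (\<lambda>t. cis (2 * pi * t)) -` W"
    by (meson open_contains_ball)
  have "0 < ennreal (min e 1)"
    using e(1) by simp
  also have "\<dots> = emeasure lborel {0..<min e 1}"
    using e(1) by simp
  also have "\<dots> \<le> emeasure lborel ({0..<1} \<inter> {t. cis (2 * pi * t) \<in> W})"
  proof (rule emeasure_mono)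
    show "{0..<min e 1} \<subseteq> {0..<1} \<inter> {t. cis (2 * pi * t) \<in> W}"
      using e(2) by (auto simp: subset_iff)
    have "(\<lambda>t. cis (2 * pi * t)) -` W \<in> sets borel"
      using \<open>open ((\<lambda>t. cis (2 * pi * t)) -` W)\<close> by simp
    then show "{0..<1} \<inter> {t. cis (2 * pi * t) \<in> W} \<in> sets lborel"
      by (simp add: vimage_def)
  qed
  also have "\<dots> = emeasure circle_measure W"
    using assms by (simp add: emeasure_circle_measure)
  finally show ?thesis .
qed

lemma AE_circle_measure_unimodular: "AE z in circle_measure. cmod z = 1"
  unfolding circle_measure_def using cis_borel_measurable
  by (subst AE_distr_iff) auto

section \<open>Invariant measures from eigenvectors\<close>

text \<open>The measure may depend on the point; the points reached in this way are closed under the addition of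
  eigenvectors.\<close>
definition in_invariant_support :: "('a :: real_normed_vector \<Rightarrow> 'a) \<Rightarrow> 'a \<Rightarrow> bool" where
  "in_invariant_support T x \<longleftrightarrow> (\<exists>\<mu>. invariant_prob_measure T \<mu> \<and> finite_second_moment \<mu> \<and>
     (\<forall>U. open U \<longrightarrow> x \<in> U \<longrightarrow> emeasure \<mu> U > 0))"

lemma in_invariant_support_0:
  fixes T :: "'a :: complex_inner \<Rightarrow> 'a"
  assumes "bounded_clinear T"
  shows "in_invariant_support T 0"
  unfolding in_invariant_support_def
proof (intro exI[of _ "return borel 0"] conjI allI impI)
  show "invariant_prob_measure T (return borel 0)"
    unfolding invariant_prob_measure_def
  proof (intro conjI ballI)
    fix A :: "'a set" assume A: "A \<in> sets borel"
    have "T -` A \<in> sets borel"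
      using measurable_sets[OF bounded_clinear_borel_measurable_funpow[OF assms, of 1] A] by simp
    then show "emeasure (return borel 0) (T -` A) = emeasure (return borel 0) A"
      using A bounded_clinear_funpow(3)[OF assms, of 1] by (simp add: indicator_def)
  qed (auto intro: prob_space_return)
  show "finite_second_moment (return borel (0 :: 'a))"
    unfolding finite_second_moment_def by (subst nn_integral_return) auto
qed auto

text \<open>If \<open>y\<close> has law \<open>\<mu>\<close> and \<open>z\<close> is uniform on the circle and independent of \<open>y\<close>, then \<open>z x + y\<close> has an
  invariant law: \<open>T\<close> maps it to \<open>(l z) x + T y\<close>, and the pair \<open>(T y, l z)\<close> has the same law as \<open>(y, z)\<close>.\<close>
lemma in_invariant_support_add_eigenvector:
  fixes T :: "'a :: separable_complex_hilbert_space \<Rightarrow> 'a"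
  assumes T: "bounded_clinear T" and x: "cmod l = 1" "T x = l *\<^sub>C x" and y: "in_invariant_support T y"
  shows "in_invariant_support T (x + y)"
proof -
  obtain \<mu> where \<mu>: "invariant_prob_measure T \<mu>" "finite_second_moment \<mu>"
    "\<And>U. open U \<Longrightarrow> y \<in> U \<Longrightarrow> emeasure \<mu> U > 0"
    using y unfolding in_invariant_support_def by blast
  have sets_\<mu>[measurable_cong]: "sets \<mu> = sets borel"
    using \<mu>(1) by (simp add: invariant_prob_measure_def)
  interpret \<mu>: prob_space \<mu>
    using \<mu>(1) by (simp add: invariant_prob_measure_def)
  interpret \<nu>: prob_space circle_measure
    by (rule prob_space_circle_measure)
  interpret P: pair_prob_space \<mu> circle_measure ..
  note sets_circle_measure[measurable_cong]
  define g where "g = (\<lambda>(y, z). z *\<^sub>C x + y)"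
  define F where "F = (\<lambda>(y, z). (T y, l * z))"
  have sets_pair: "sets (\<mu> \<Otimes>\<^sub>M circle_measure) = sets borel"
    using sets_pair_measure_cong[OF sets_\<mu> sets_circle_measure] unfolding borel_prod .
  have space_pair: "space (\<mu> \<Otimes>\<^sub>M circle_measure) = UNIV"
    using sets_eq_imp_space_eq[OF sets_pair] by simp
  have cont_g: "continuous_on UNIV g"
    unfolding g_def case_prod_unfold
    by (intro continuous_intros bounded_linear.continuous_on[OF bounded_linear_scaleC_left])
  have g: "g \<in> borel_measurable (\<mu> \<Otimes>\<^sub>M circle_measure)"
    using borel_measurable_continuous_onI[OF cont_g] by (simp add: measurable_cong_sets[OF sets_pair refl])
  have T_meas: "T \<in> measurable \<mu> \<mu>"
    using bounded_clinear_borel_measurable_funpow[OF T, of 1] by (simp add: measurable_cong_sets[OF sets_\<mu> sets_\<mu>])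
  have rot_meas: "(\<lambda>z. l * z) \<in> measurable circle_measure circle_measure"
    by measurable
  have rot: "distr circle_measure circle_measure (\<lambda>z. l * z) = circle_measure"
  proof (rule measure_eqI)
    fix A assume "A \<in> sets (distr circle_measure circle_measure (\<lambda>z. l * z))"
    then have A: "A \<in> sets circle_measure" "A \<in> sets borel"
      by (simp_all add: sets_circle_measure)
    have "space circle_measure = UNIV"
      using sets_eq_imp_space_eq[OF sets_circle_measure] by simp
    then have "emeasure (distr circle_measure circle_measure (\<lambda>z. l * z)) A
        = emeasure circle_measure {z. l * z \<in> A}"
      by (simp add: emeasure_distr[OF rot_meas A(1)] vimage_def)
    then show "emeasure (distr circle_measure circle_measure (\<lambda>z. l * z)) A = emeasure circle_measure A"
      by (simp add: circle_measure_rotation_invariant[OF A(2) x(1)])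
  qed simp
  have F_meas: "F \<in> measurable (\<mu> \<Otimes>\<^sub>M circle_measure) (\<mu> \<Otimes>\<^sub>M circle_measure)"
    unfolding F_def using T_meas rot_meas by measurable
  have distr_F: "distr (\<mu> \<Otimes>\<^sub>M circle_measure) (\<mu> \<Otimes>\<^sub>M circle_measure) F = \<mu> \<Otimes>\<^sub>M circle_measure"
  proof -
    have "distr \<mu> \<mu> T \<Otimes>\<^sub>M distr circle_measure circle_measure (\<lambda>z. l * z)
        = distr (\<mu> \<Otimes>\<^sub>M circle_measure) (\<mu> \<Otimes>\<^sub>M circle_measure) F"
      unfolding F_def
      by (rule pair_measure_distr[OF T_meas rot_meas]) (simp add: rot \<nu>.sigma_finite_measure_axioms)
    then show ?thesis
      using invariant_prob_measure_distr_funpow[OF T \<mu>(1), of 1] by (simp add: rot)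
  qed
  have Tg: "T (g p) = g (F p)" for p
    using T x(2) unfolding g_def F_def
    by (auto simp: bounded_clinear_def linear_add[OF bounded_linear.linear] scaleC_scaleC mult.commute split: prod.split)
  define m where "m = distr (\<mu> \<Otimes>\<^sub>M circle_measure) borel g"
  have m_emeasure: "emeasure m A = emeasure (\<mu> \<Otimes>\<^sub>M circle_measure) (g -` A)" if "A \<in> sets borel" for A
    unfolding m_def using g that by (simp add: emeasure_distr space_pair)
  have "invariant_prob_measure T m"
    unfolding invariant_prob_measure_def
  proof (intro conjI ballI)
    show "prob_space m"
      unfolding m_def by (intro P.prob_space_distr g)
    show "sets m = sets borel"
      by (simp add: m_def)
    fix A :: "'a set" assume A: "A \<in> sets borel"
    have TA: "T -` A \<in> sets borel"
      using measurable_sets[OF bounded_clinear_borel_measurable_funpow[OF T, of 1] A] by simp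
    have gA: "g -` A \<in> sets (\<mu> \<Otimes>\<^sub>M circle_measure)"
      using measurable_sets[OF g A] by (simp add: space_pair)
    have "emeasure m (T -` A) = emeasure (\<mu> \<Otimes>\<^sub>M circle_measure) (F -` (g -` A))"
      by (subst m_emeasure[OF TA]) (simp add: vimage_def Tg)
    also have "\<dots> = emeasure (distr (\<mu> \<Otimes>\<^sub>M circle_measure) (\<mu> \<Otimes>\<^sub>M circle_measure) F) (g -` A)"
      by (simp add: emeasure_distr[OF F_meas gA] space_pair)
    also have "\<dots> = emeasure m A"
      by (simp add: distr_F m_emeasure[OF A])
    finally show "emeasure m (T -` A) = emeasure m A" .
  qed
  moreover have "finite_second_moment m"
  proof -
    have "(\<integral>\<^sup>+z. ennreal ((norm z)\<^sup>2) \<partial>m) = (\<integral>\<^sup>+p. ennreal ((norm (g p))\<^sup>2) \<partial>(\<mu> \<Otimes>\<^sub>M circle_measure))"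
      unfolding m_def by (rule nn_integral_distr[OF g]) measurable
    also have "\<dots> = (\<integral>\<^sup>+y. \<integral>\<^sup>+z. ennreal ((norm (g (y, z)))\<^sup>2) \<partial>circle_measure \<partial>\<mu>)"
      by (rule \<nu>.nn_integral_fst[symmetric]) (rule measurable_compose[OF g], measurable)
    also have "\<dots> \<le> (\<integral>\<^sup>+y. \<integral>\<^sup>+z. ennreal (2 * (norm x)\<^sup>2 + 2 * (norm y)\<^sup>2) \<partial>circle_measure \<partial>\<mu>)"
    proof (rule nn_integral_mono, rule nn_integral_mono_AE)
      fix y
      show "AE z in circle_measure. ennreal ((norm (g (y, z)))\<^sup>2) \<le> ennreal (2 * (norm x)\<^sup>2 + 2 * (norm y)\<^sup>2)"
        using AE_circle_measure_unimodular
      proof (rule eventually_mono)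
        fix z assume "cmod z = 1"
        then show "ennreal ((norm (g (y, z)))\<^sup>2) \<le> ennreal (2 * (norm x)\<^sup>2 + 2 * (norm y)\<^sup>2)"
          using sq_norm_add_le[of "z *\<^sub>C x" y] by (intro ennreal_leI) (simp add: g_def norm_scaleC)
      qed
    qed
    also have "\<dots> = (\<integral>\<^sup>+y. ennreal (2 * (norm x)\<^sup>2) + 2 * ennreal ((norm y)\<^sup>2) \<partial>\<mu>)"
      by (simp add: \<nu>.emeasure_space_1 ennreal_mult'')
    also have "\<dots> = ennreal (2 * (norm x)\<^sup>2) + 2 * (\<integral>\<^sup>+y. ennreal ((norm y)\<^sup>2) \<partial>\<mu>)"
      by (subst nn_integral_add, measurable) (simp add: nn_integral_cmult \<mu>.emeasure_space_1)
    also have "\<dots> < \<infinity>"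
      using \<mu>(2) unfolding finite_second_moment_def by (simp add: ennreal_mult_less_top)
    finally show ?thesis
      unfolding finite_second_moment_def .
  qed
  moreover have "emeasure m U > 0" if U: "open U" "x + y \<in> U" for U
  proof -
    have "open (g -` U)"
      using U(1) cont_g by (simp add: open_vimage)
    moreover have "(y, 1) \<in> g -` U"
      using U(2) by (simp add: g_def scaleC_one)
    ultimately obtain V W where VW: "open V" "open W" "(y, 1) \<in> V \<times> W" "V \<times> W \<subseteq> g -` U"
      by (rule open_prod_elim) blast
    have "0 < emeasure \<mu> V * emeasure circle_measure W"
      using \<mu>(3)[of V] circle_measure_neighbourhood_1[of W] VW by (simp add: ennreal_zero_less_mult_iff)
    also have "\<dots> = emeasure (\<mu> \<Otimes>\<^sub>M circle_measure) (V \<times> W)"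
      using VW by (intro \<nu>.emeasure_pair_measure_Times[symmetric]) (auto simp: sets_\<mu> sets_circle_measure)
    also have "\<dots> \<le> emeasure (\<mu> \<Otimes>\<^sub>M circle_measure) (g -` U)"
      using VW \<open>open (g -` U)\<close> by (intro emeasure_mono) (auto simp: sets_pair)
    also have "\<dots> = emeasure m U"
      using U by (simp add: m_emeasure)
    finally show ?thesis .
  qed
  ultimately show ?thesis
    unfolding in_invariant_support_def by blast
qed

lemma in_invariant_support_cspan:
  fixes T :: "'a :: separable_complex_hilbert_space \<Rightarrow> 'a"
  assumes T: "bounded_clinear T" and "x \<in> cspan (unimodular_eigenvectors T)"
  shows "in_invariant_support T x"
  using assms(2)
proof (induction rule: complex_vector.span_induct_alt)
  case base
  show ?case
    by (rule in_invariant_support_0[OF T])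
next
  case (step c x y)
  obtain l where "cmod l = 1" "T (c *\<^sub>C x) = l *\<^sub>C (c *\<^sub>C x)"
    by (rule unimodular_eigenvectors_scaleCE[OF T step(1)])
  then show ?case
    using step(2) by (rule in_invariant_support_add_eigenvector[OF T])
qed

text \<open>The weights \<open>2\<^sup>-\<^sup>k / (1 + s k)\<close>, normalised, are positive and give \<open>s\<close> a finite mean.\<close>
lemma exists_pmf_finite_mean:
  fixes s :: "nat \<Rightarrow> real"
  assumes s: "\<And>k. s k \<ge> 0"
  obtains p :: "nat pmf" where "\<And>k. pmf p k > 0" "(\<integral>\<^sup>+k. ennreal (s k) \<partial>measure_pmf p) < \<infinity>"
proof -
  define w where "w k = (1 / 2) ^ Suc k / (1 + s k)" for k
  have s1: "1 + s k > 0" for k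
    using s[of k] by linarith
  have w_pos: "w k > 0" for k
    unfolding w_def by (intro divide_pos_pos s1) simp
  have geo: "summable (\<lambda>k. (1 / 2 :: real) ^ Suc k)"
    by (rule sums_summable[OF power_half_series])
  have w_le: "w k \<le> (1 / 2) ^ Suc k" "w k * s k \<le> (1 / 2) ^ Suc k" for k
    using s[of k] s1[of k] mult_left_mono[of 1 "1 + s k" "(1 / 2) ^ Suc k"]
      mult_left_mono[of "s k" "1 + s k" "(1 / 2) ^ Suc k"]
    by (simp_all add: w_def pos_divide_le_eq del: power_Suc)
  have summ: "summable w"
    by (rule summable_comparison_test'[OF geo, of 0]) (use w_le w_pos in \<open>simp add: less_imp_le del: power_Suc\<close>)
  have summ': "summable (\<lambda>k. w k * s k)"
    by (rule summable_comparison_test'[OF geo, of 0])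
       (use w_le(2) w_pos s in \<open>simp add: less_imp_le del: power_Suc\<close>)
  define S where "S = (\<Sum>k. w k)"
  have S: "S > 0"
    unfolding S_def by (rule suminf_pos[OF summ w_pos])
  define p where "p = embed_pmf (\<lambda>k. w k / S)"
  have nonneg: "w k / S \<ge> 0" for k
    using w_pos[of k] S by simp
  have "(\<integral>\<^sup>+k. ennreal (w k / S) \<partial>count_space UNIV) = (\<Sum>k. ennreal (w k / S))"
    by (rule nn_integral_count_space_nat)
  also have "\<dots> = ennreal (\<Sum>k. w k / S)"
    by (intro suminf_ennreal2 nonneg summable_divide summ)
  also have "(\<Sum>k. w k / S) = 1"
    using S by (simp add: suminf_divide[OF summ] flip: S_def)
  finally have p: "pmf p k = w k / S" for k
    unfolding p_def using nonneg by (intro pmf_embed_pmf) auto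
  have "(\<integral>\<^sup>+k. ennreal (s k) \<partial>measure_pmf p) = (\<Sum>k. ennreal (pmf p k) * ennreal (s k))"
    by (simp add: nn_integral_measure_pmf nn_integral_count_space_nat)
  also have "\<dots> = (\<Sum>k. ennreal (w k * s k / S))"
    using s nonneg by (simp add: p flip: ennreal_mult)
  also have "\<dots> = ennreal (\<Sum>k. w k * s k / S)"
    using s w_pos S by (intro suminf_ennreal2 summable_divide summ') (simp add: less_imp_le)
  also have "\<dots> < \<infinity>"
    by simp
  finally show ?thesis
    using that[of p] w_pos S p by simp
qed

text \<open>The weights of the mixture are adapted to the second moments, which need not be bounded in \<open>k\<close>.\<close>
lemma invariant_measure_mixture:
  fixes T :: "'a :: complex_inner \<Rightarrow> 'a" and \<mu> :: "nat \<Rightarrow> 'a measure"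
  assumes T: "bounded_clinear T"
    and \<mu>: "\<And>k. invariant_prob_measure T (\<mu> k)" "\<And>k. finite_second_moment (\<mu> k)"
  obtains m where "invariant_prob_measure T m" "finite_second_moment m"
    "\<And>A k. A \<in> sets borel \<Longrightarrow> emeasure (\<mu> k) A > 0 \<Longrightarrow> emeasure m A > 0"
proof -
  define s where "s k = enn2real (\<integral>\<^sup>+z. ennreal ((norm z)\<^sup>2) \<partial>\<mu> k)" for k
  have s: "ennreal (s k) = (\<integral>\<^sup>+z. ennreal ((norm z)\<^sup>2) \<partial>\<mu> k)" for k
    using \<mu>(2)[of k] by (simp add: s_def finite_second_moment_def)
  obtain p :: "nat pmf" where p: "\<And>k. pmf p k > 0" "(\<integral>\<^sup>+k. ennreal (s k) \<partial>measure_pmf p) < \<infinity>"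
    by (rule exists_pmf_finite_mean[of s]) (auto simp: s_def)
  have sets: "sets (\<mu> k) = sets borel" and prob: "prob_space (\<mu> k)" for k
    using \<mu>(1)[of k] by (auto simp: invariant_prob_measure_def)
  have meas: "\<mu> \<in> measurable (measure_pmf p) (subprob_algebra borel)"
    using sets prob by (auto simp: space_subprob_algebra prob_space_imp_subprob_space
        measurable_cong_sets[OF sets_measure_pmf_count_space refl])
  define m where "m = measure_pmf p \<bind> \<mu>"
  have sets_m: "sets m = sets borel"
    unfolding m_def by (rule sets_bind) (auto simp: sets)
  have m: "emeasure m A = (\<integral>\<^sup>+k. emeasure (\<mu> k) A \<partial>measure_pmf p)" if "A \<in> sets borel" for A
    unfolding m_def using meas that by (intro emeasure_bind) auto
  show ?thesis
  proof (rule that[of m])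
    show "invariant_prob_measure T m"
      unfolding invariant_prob_measure_def
    proof (intro conjI ballI sets_m)
      have "emeasure (\<mu> k) UNIV = 1" for k
        using prob_space.emeasure_space_1[OF prob] sets_eq_imp_space_eq[OF sets] by (metis space_borel)
      then have "emeasure m UNIV = 1"
        by (subst m) (auto simp: measure_pmf.emeasure_space_1)
      then show "prob_space m"
        using sets_eq_imp_space_eq[OF sets_m] by (intro prob_spaceI) simp
      fix A :: "'a set" assume A: "A \<in> sets borel"
      have "T -` A \<in> sets borel"
        using measurable_sets[OF bounded_clinear_borel_measurable_funpow[OF T, of 1] A] by simp
      then show "emeasure m (T -` A) = emeasure m A"
        using \<mu>(1) A by (simp add: m invariant_prob_measure_def)
    qed
    have "(\<integral>\<^sup>+z. ennreal ((norm z)\<^sup>2) \<partial>m) = (\<integral>\<^sup>+k. (\<integral>\<^sup>+z. ennreal ((norm z)\<^sup>2) \<partial>\<mu> k) \<partial>measure_pmf p)"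
      unfolding m_def using meas by (intro nn_integral_bind[where B = borel]) auto
    then show "finite_second_moment m"
      using p(2) by (simp add: finite_second_moment_def s)
    fix A k assume A: "A \<in> sets borel" "emeasure (\<mu> k) A > 0"
    have "0 < ennreal (pmf p k) * emeasure (\<mu> k) A"
      using A(2) p(1)[of k] by (simp add: ennreal_zero_less_mult_iff)
    also have "\<dots> \<le> (\<Sum>k. ennreal (pmf p k) * emeasure (\<mu> k) A)"
      using sum_le_suminf[of "\<lambda>k. ennreal (pmf p k) * emeasure (\<mu> k) A" "{k}"] by simp
    also have "\<dots> = emeasure m A"
      using A(1) by (simp add: m nn_integral_measure_pmf nn_integral_count_space_nat)
    finally show "emeasure m A > 0" .
  qed
qed

text \<open>Each set of a countable basis contains a point of the span, and thus is charged by some invariant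
  measure; these countably many measures are mixed.\<close>
lemma exists_full_support_invariant_measure:
  fixes T :: "'a :: separable_complex_hilbert_space \<Rightarrow> 'a"
  assumes T: "bounded_clinear T" and dense: "dense (cspan (unimodular_eigenvectors T))"
  shows "\<exists>\<mu>. invariant_prob_measure T \<mu> \<and> full_support \<mu> \<and> finite_second_moment \<mu>"
proof -
  obtain B :: "'a set set" where B: "countable B" "topological_basis B"
    using ex_countable_basis by blast
  define B' where "B' = B - {{}}"
  have ex: "\<exists>\<mu>. invariant_prob_measure T \<mu> \<and> finite_second_moment \<mu> \<and> emeasure \<mu> U > 0"
    if U: "U \<in> B'" for U
  proof -
    have "open U" "U \<noteq> {}"
      using U topological_basis_open[OF B(2)] by (auto simp: B'_def)
    then obtain x where "x \<in> U" "x \<in> cspan (unimodular_eigenvectors T)"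
      using dense open_Int_closure_eq_empty[of U "cspan (unimodular_eigenvectors T)"]
      unfolding dense_def by auto
    then show ?thesis
      using in_invariant_support_cspan[OF T] \<open>open U\<close> unfolding in_invariant_support_def by blast
  qed
  have "B' \<noteq> {}"
  proof -
    obtain V where "V \<in> B" "(0 :: 'a) \<in> V"
      using topological_basisE[OF B(2) open_UNIV, of 0] by blast
    then show ?thesis
      unfolding B'_def by blast
  qed
  then have enum: "range (from_nat_into B') = B'"
    using B(1) by (intro range_from_nat_into) (auto simp: B'_def)
  then have "\<forall>k. \<exists>\<mu>. invariant_prob_measure T \<mu> \<and> finite_second_moment \<mu> \<and> emeasure \<mu> (from_nat_into B' k) > 0"
    using ex by blast
  then obtain \<mu> where \<mu>: "\<And>k. invariant_prob_measure T (\<mu> k)" "\<And>k. finite_second_moment (\<mu> k)"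
    "\<And>k. emeasure (\<mu> k) (from_nat_into B' k) > 0"
    by metis
  obtain m where m: "invariant_prob_measure T m" "finite_second_moment m"
    "\<And>A k. A \<in> sets borel \<Longrightarrow> emeasure (\<mu> k) A > 0 \<Longrightarrow> emeasure m A > 0"
    using invariant_measure_mixture[where \<mu> = \<mu>, OF T \<mu>(1,2)] by metis
  have sets_m: "sets m = sets borel"
    using m(1) by (simp add: invariant_prob_measure_def)
  have "emeasure m U > 0" if U: "open U" "U \<noteq> {}" for U
  proof -
    obtain x where "x \<in> U"
      using U by blast
    then obtain V where V: "V \<in> B" "x \<in> V" "V \<subseteq> U"
      using topological_basisE[OF B(2) U(1)] by metis
    then have "V \<in> B'"
      by (auto simp: B'_def)
    then obtain k where "V = from_nat_into B' k"
      using enum by (metis rangeE)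
    moreover have "open V"
      using V topological_basis_open[OF B(2)] by blast
    ultimately have "0 < emeasure m V"
      using m(3)[of V k] \<mu>(3)[of k] by auto
    also have "\<dots> \<le> emeasure m U"
      using V U by (intro emeasure_mono) (auto simp: sets_m)
    finally show ?thesis .
  qed
  then show ?thesis
    using m unfolding full_support_def by blast
qed

section \<open>The equivalences\<close>

text \<open>If the span is not dense, some nonzero \<open>v\<close> is orthogonal to all eigenvectors, but a measure of full
  support charges the open half-space where the inner product with \<open>v\<close> is positive.\<close>
lemma dense_cspan_if_full_support:
  fixes T :: "'a :: separable_complex_hilbert_space \<Rightarrow> 'a"
  assumes T: "bounded_clinear T"
    and \<mu>: "invariant_prob_measure T \<mu>" "full_support \<mu>" "finite_second_moment \<mu>"
  shows "dense (cspan (unimodular_eigenvectors T))"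
  unfolding dense_def
proof (intro equalityI subset_UNIV subsetI, rule ccontr)
  fix x assume "x \<notin> closure (cspan (unimodular_eigenvectors T))"
  then obtain v where v: "\<And>y. y \<in> unimodular_eigenvectors T \<Longrightarrow> inner y v = 0" "inner x v > 0"
    using separate_from_closure_cspan by blast
  have sets: "sets \<mu> = sets borel"
    using \<mu>(1) by (simp add: invariant_prob_measure_def)
  have U: "open {z. inner v z > 0}" "{z. inner v z > 0} \<noteq> {}"
    using v(2) open_halfspace_gt[of 0 v] by (auto simp: inner_commute)
  then have "emeasure \<mu> {z. inner v z > 0} > 0"
    using \<mu>(2) unfolding full_support_def by blast
  moreover have "emeasure \<mu> {z. inner v z > 0} = 0" if "AE z in \<mu>. inner z v = 0"
  proof -
    have "AE z in \<mu>. \<not> inner v z > 0"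
      using that by (auto simp: inner_commute)
    then show ?thesis
      using AE_iff_measurable[of "{z. inner v z > 0}" \<mu> "\<lambda>z. \<not> inner v z > 0"] U(1)
        sets_eq_imp_space_eq[OF sets] by (simp add: sets)
  qed
  ultimately have "\<not> (AE z in \<mu>. inner z v = 0)"
    by auto
  then show False
    using eigenvector_from_invariant_measure[OF T \<mu>(1,3)] v(1) by fastforce
qed

text \<open>A measure that charges the complement of the origin, which is a neighbourhood of \<open>e\<close>, differs from
  the point mass at \<open>0\<close>.\<close>
lemma exists_nontrivial_invariant_measure:
  fixes T :: "'a :: separable_complex_hilbert_space \<Rightarrow> 'a"
  assumes T: "bounded_clinear T" and e: "e \<in> unimodular_eigenvectors T"
  shows "\<exists>\<mu>. invariant_prob_measure T \<mu> \<and> nontrivial_measure \<mu> \<and> finite_second_moment \<mu>"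
proof -
  have "e \<noteq> 0"
    using e by (simp add: unimodular_eigenvectors_def)
  obtain \<mu> where \<mu>: "invariant_prob_measure T \<mu>" "finite_second_moment \<mu>"
    "\<And>U. open U \<Longrightarrow> e \<in> U \<Longrightarrow> emeasure \<mu> U > 0"
    using in_invariant_support_cspan[OF T complex_vector.span_base[OF e]]
    unfolding in_invariant_support_def by blast
  have "emeasure \<mu> (- {0}) > 0"
    using \<open>e \<noteq> 0\<close> by (intro \<mu>(3)) auto
  moreover have "emeasure (return borel (0 :: 'a)) (- {0}) = 0"
    by simp
  ultimately have "nontrivial_measure \<mu>"
    unfolding nontrivial_measure_def by auto
  then show ?thesis
    using \<mu> by blast
qed

text \<open>The closed span is \<open>{0}\<close> when there are no eigenvectors; therefore both nontriviality and
  density of \<open>S\<close> are decided by the eigenvectors alone.\<close>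
lemma between_cspan_and_closure:
  fixes T :: "'a :: complex_inner \<Rightarrow> 'a"
  assumes "cspan (unimodular_eigenvectors T) \<subseteq> S" "S \<subseteq> closure (cspan (unimodular_eigenvectors T))"
  shows "closure S = closure (cspan (unimodular_eigenvectors T))"
    and "S - {0} \<noteq> {} \<longleftrightarrow> unimodular_eigenvectors T \<noteq> {}"
    and "dense S \<longleftrightarrow> dense (cspan (unimodular_eigenvectors T))"
proof -
  show eq: "closure S = closure (cspan (unimodular_eigenvectors T))"
    using assms by (metis closure_closure closure_mono subset_antisym)
  then show "dense S \<longleftrightarrow> dense (cspan (unimodular_eigenvectors T))"
    by (simp add: dense_def)
  show "S - {0} \<noteq> {} \<longleftrightarrow> unimodular_eigenvectors T \<noteq> {}"
  proof
    assume "S - {0} \<noteq> {}"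
    then show "unimodular_eigenvectors T \<noteq> {}"
      using assms(2) by auto
  next
    assume "unimodular_eigenvectors T \<noteq> {}"
    then obtain e where e: "e \<in> unimodular_eigenvectors T"
      by blast
    then have "e \<in> S"
      using assms(1) complex_vector.span_base by blast
    moreover have "e \<noteq> 0"
      using e by (simp add: unimodular_eigenvectors_def)
    ultimately show "S - {0} \<noteq> {}"
      by blast
  qed
qed

lemma all_equivalentI: "(\<And>P. P \<in> set Ps \<Longrightarrow> P \<longleftrightarrow> Q) \<Longrightarrow> all_equivalent Ps"
  unfolding all_equivalent_def by blast

theorem theorem1p7:
  fixes T :: "'a :: separable_complex_hilbert_space \<Rightarrow> 'a"
  assumes "bounded_clinear T"
  shows "closure (cspan (unimodular_eigenvectors T)) = closure (URec T) \<and>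
    closure (URec T) = closure (RRec_bo T) \<and>
    all_equivalent
      [unimodular_eigenvectors T \<noteq> {},
       Delta_star_Rec T - {0} \<noteq> {},
       IP_star_Rec T - {0} \<noteq> {},
       URec T - {0} \<noteq> {},
       FRec_bo T - {0} \<noteq> {},
       UFRec_bo T - {0} \<noteq> {},
       RRec_bo T - {0} \<noteq> {},
       \<exists>\<mu>. invariant_prob_measure T \<mu> \<and> nontrivial_measure \<mu> \<and> finite_second_moment \<mu>] \<and>
    all_equivalent
      [dense (cspan (unimodular_eigenvectors T)),
       Delta_star_recurrent T,
       IP_star_recurrent T,
       uniformly_recurrent T,
       dense (FRec_bo T),
       dense (UFRec_bo T),
       dense (RRec_bo T),
       \<exists>\<mu>. invariant_prob_measure T \<mu> \<and> full_support \<mu> \<and> finite_second_moment \<mu>]"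
proof -
  have "bounded_linear T"
    using assms by (simp add: bounded_clinear_def)
  note chain = cspan_subset_Delta_star_Rec[OF assms] Delta_star_Rec_subset_IP_star_Rec[of T]
    IP_star_Rec_subset_URec[of T] URec_subset_FRec_bo[OF \<open>bounded_linear T\<close>]
    FRec_bo_subset_UFRec_bo[of T] UFRec_bo_subset_RRec_bo[of T]
    RRec_bo_subset_closure_cspan[OF assms]
  have sub: "cspan (unimodular_eigenvectors T) \<subseteq> S \<and> S \<subseteq> closure (cspan (unimodular_eigenvectors T))"
    if "S \<in> {Delta_star_Rec T, IP_star_Rec T, URec T, FRec_bo T, UFRec_bo T, RRec_bo T}" for S
    using that chain by blast
  have nontrivial: "(\<exists>\<mu>. invariant_prob_measure T \<mu> \<and> nontrivial_measure \<mu> \<and> finite_second_moment \<mu>)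
      \<longleftrightarrow> unimodular_eigenvectors T \<noteq> {}"
    using exists_nontrivial_invariant_measure[OF assms] invariant_measure_eq_return_0_if_no_unimodular_eigenvectors[OF assms]
    unfolding nontrivial_measure_def by blast
  have full: "(\<exists>\<mu>. invariant_prob_measure T \<mu> \<and> full_support \<mu> \<and> finite_second_moment \<mu>)
      \<longleftrightarrow> dense (cspan (unimodular_eigenvectors T))"
    using exists_full_support_invariant_measure[OF assms] dense_cspan_if_full_support[OF assms] by blast
  have closures: "closure S = closure (cspan (unimodular_eigenvectors T))"
    and nonzero: "S - {0} \<noteq> {} \<longleftrightarrow> unimodular_eigenvectors T \<noteq> {}"
    and dense: "dense S \<longleftrightarrow> dense (cspan (unimodular_eigenvectors T))"
    if "S \<in> {Delta_star_Rec T, IP_star_Rec T, URec T, FRec_bo T, UFRec_bo T, RRec_bo T}" for S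
    by (rule between_cspan_and_closure[OF conjunct1[OF sub] conjunct2[OF sub]], rule that, rule that)+
  show ?thesis
    unfolding Delta_star_recurrent_def IP_star_recurrent_def uniformly_recurrent_def
  proof (intro conjI)
    show "closure (cspan (unimodular_eigenvectors T)) = closure (URec T)" "closure (URec T) = closure (RRec_bo T)"
      by (simp_all add: closures)
  next
    show "all_equivalent
      [unimodular_eigenvectors T \<noteq> {}, Delta_star_Rec T - {0} \<noteq> {}, IP_star_Rec T - {0} \<noteq> {},
       URec T - {0} \<noteq> {}, FRec_bo T - {0} \<noteq> {}, UFRec_bo T - {0} \<noteq> {}, RRec_bo T - {0} \<noteq> {},
       \<exists>\<mu>. invariant_prob_measure T \<mu> \<and> nontrivial_measure \<mu> \<and> finite_second_moment \<mu>]"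
      by (rule all_equivalentI[where Q = "unimodular_eigenvectors T \<noteq> {}"], unfold list.set insert_iff empty_iff,
          elim disjE FalseE; simp only: nonzero nontrivial insert_iff simp_thms)
  next
    show "all_equivalent
      [dense (cspan (unimodular_eigenvectors T)), dense (Delta_star_Rec T), dense (IP_star_Rec T),
       dense (URec T), dense (FRec_bo T), dense (UFRec_bo T), dense (RRec_bo T),
       \<exists>\<mu>. invariant_prob_measure T \<mu> \<and> full_support \<mu> \<and> finite_second_moment \<mu>]"
      by (rule all_equivalentI[where Q = "dense (cspan (unimodular_eigenvectors T))"], unfold list.set insert_iff empty_iff,
          elim disjE FalseE; simp only: dense full insert_iff simp_thms)
  qed
qed

end
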